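(* Let $G=(\mathcal{C},\mathcal{S},S,p)$ be a context-free grammar of arrows over a finitely generated category $\mathcal{C}$, and let $M=(\mathcal{C},\mathcal{Q},p_M:\mathcal{Q}\to\mathcal{C},q_0,q_f)$ be a non-deterministic finite state automaton over $\mathcal{C}$ with $p(S)=(p_M(q_0),p_M(q_f))$. Let $G'=(\mathcal{Q},\mathcal{S}',S',p')$ be the pullback grammar of $G$ along $M$ and let $G''=(\mathcal{C},\mathcal{S}',S',\mathcal{W}[p_M]\circ p')$ be its functorial image along $p_M$. Then $$L_{G'}=p_M^{-1}(L_G)\cap\mathcal{Q}(q_0,q_f)\qquad\text{and}\qquad L_{G''}=L_G\cap L_M.$$
   Context: "Operad" means colored non-symmetric operad (multicategory); a functor of operads preserves types, identities and composition. A constant is an operation of arity $0$; $\alpha:S$ means $\alpha$ is a constant with output color $S$. Composition of arrows in categories is written in diagrammatic order. A species consists of a set of colors and a set of nodes, each node $x:R_1,\dots,R_n\to R$ having a list of input colors and an output color; it is finite if both sets are finite. $\mathsf{Free}\,\mathcal{S}$ is the free operad on $\mathcal{S}$. A functor of operads out of $\mathsf{Free}\,\mathcal{S}$ is determined by its (type-preserving) values on colors and nodes. The operad $\mathcal{W}[\mathcal{C}]$ of spliced arrows has as colors the pairs $(A,B)$ of objects of $\mathcal{C}$; an $n$-ary operation $(A_1,B_1),\dots,(A_n,B_n)\to(A,B)$ is a sequence $w_0{-}\cdots{-}w_n$ of arrows $w_i:B_i\to A_{i+1}$ ($0\le i\le n$, with $B_0=A$, $A_{n+1}=B$). Composition substitutes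 spliced arrows for the gaps "$-$", interpreting juxtaposition as composition in $\mathcal{C}$; the identity on $(A,B)$ is $\mathrm{id}_A{-}\mathrm{id}_B$. For a functor $F$, $\mathcal{W}[F]$ applies $F$ componentwise. Constants of color $(A,B)$ are exactly arrows $A\to B$. A context-free grammar of arrows $G=(\mathcal{C},\mathcal{S},S,p)$ consists of a finitely generated category $\mathcal{C}$, a finite species $\mathcal{S}$, a color $S$, and a functor of operads $p:\mathsf{Free}\,\mathcal{S}\to\mathcal{W}[\mathcal{C}]$. Its language is $L_G=\{p(\alpha)\mid\alpha:S\}$. A functor $p:\mathcal{Q}\to\mathcal{C}$ is ULF if for every arrow $\alpha$ of $\mathcal{Q}$ with $p(\alpha)=uv$ there is a unique pair $(\beta,\gamma)$ with $\alpha=\beta\gamma$, $p(\beta)=u$, $p(\gamma)=v$; it is finitary if fibers of objects and of arrows are finite. A non-deterministic finite state automaton over $\mathcal{C}$ is $M=(\mathcal{C},\mathcal{Q},p_M,q_0,q_f)$ with $p_M:\mathcal{Q}\to\mathcal{C}$ finitary ULF and $q_0,q_f$ objects of $\mathcal{Q}$; $L_M=\{p_M(\alpha)\mid\alpha:q_0\to q_f\}$. Pullback grammar. The species $\mathcal{S}'$ has as colors the triples $(q,R,q')$ with $R$ a color of $\mathcal{S}$, $q,q'$ objects of $\mathcal{Q}$ and $p(R)=(p_M(q),p_M(q'))$; its $n$-ary nodes $(q_1,R_1,q_1'),\dots,(q_n,R_n,q_n')\to(q,R,q')$ are pairs $(x,\alpha)$ of a node $x:R_1,\dots,R_n\to R$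 of $\mathcal{S}$ and an operation $\alpha=\alpha_0{-}\cdots{-}\alpha_n:(q_1,q_1'),\dots,(q_n,q_n')\to(q,q')$ of $\mathcal{W}[\mathcal{Q}]$ with $\mathcal{W}[p_M](\alpha)=p(x)$. The functor $p':\mathsf{Free}\,\mathcal{S}'\to\mathcal{W}[\mathcal{Q}]$ is determined by $(q,R,q')\mapsto(q,q')$ and $(x,\alpha)\mapsto\alpha$. The start symbol is $S'=(q_0,S,q_f)$. *)

theory Defs
  imports Main
begin

section \<open>Categories and functors\<close>

text \<open>Composition of arrows is in diagrammatic order: \<open>Comp C f g\<close> is \<open>f\<close> followed by \<open>g\<close>.\<close>

record ('o, 'a) category =
  Obj :: "'o set"
  Arr :: "'a set"
  Dom :: "'a \<Rightarrow> 'o"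
  Cod :: "'a \<Rightarrow> 'o"
  Idn :: "'o \<Rightarrow> 'a"
  Comp :: "'a \<Rightarrow> 'a \<Rightarrow> 'a"

definition hom :: "('o, 'a) category \<Rightarrow> 'o \<Rightarrow> 'o \<Rightarrow> 'a set" where
  "hom C A B = {f \<in> Arr C. Dom C f = A \<and> Cod C f = B}"

locale category =
  fixes C :: "('o, 'a) category"
  assumes Dom_in: "f \<in> Arr C \<Longrightarrow> Dom C f \<in> Obj C"
    and Cod_in: "f \<in> Arr C \<Longrightarrow> Cod C f \<in> Obj C"
    and Idn_in: "A \<in> Obj C \<Longrightarrow> Idn C A \<in> hom C A A"
    and Comp_in: "f \<in> Arr C \<Longrightarrow> g \<in> Arr C \<Longrightarrow> Cod C f = Dom C g \<Longrightarrow>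
      Comp C f g \<in> hom C (Dom C f) (Cod C g)"
    and Comp_Idn_left: "f \<in> Arr C \<Longrightarrow> Comp C (Idn C (Dom C f)) f = f"
    and Comp_Idn_right: "f \<in> Arr C \<Longrightarrow> Comp C f (Idn C (Cod C f)) = f"
    and Comp_assoc: "f \<in> Arr C \<Longrightarrow> g \<in> Arr C \<Longrightarrow> h \<in> Arr C \<Longrightarrow>
      Cod C f = Dom C g \<Longrightarrow> Cod C g = Dom C h \<Longrightarrow>
      Comp C (Comp C f g) h = Comp C f (Comp C g h)"

inductive_set generated_arrows :: "('o, 'a) category \<Rightarrow> 'a set \<Rightarrow> 'a set"
  for C :: "('o, 'a) category" and X :: "'a set" where
  Idn: "A \<in> Obj C \<Longrightarrow> Idn C A \<in> generated_arrows C X"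
| Comp: "x \<in> X \<Longrightarrow> g \<in> generated_arrows C X \<Longrightarrow> Cod C x = Dom C g \<Longrightarrow>
    Comp C x g \<in> generated_arrows C X"

text \<open>Generated by a finite graph: finitely many objects, and finitely many arrows
  of which every arrow is a (possibly empty) composite.\<close>

definition finitely_generated :: "('o, 'a) category \<Rightarrow> bool" where
  "finitely_generated C \<longleftrightarrow>
    finite (Obj C) \<and> (\<exists>X. finite X \<and> X \<subseteq> Arr C \<and> Arr C \<subseteq> generated_arrows C X)"

record ('o, 'a, 'p, 'b) cat_map =
  obj_map :: "'o \<Rightarrow> 'p"
  arr_map :: "'a \<Rightarrow> 'b"

locale cat_functor =
  source: category C + target: category D
  for C :: "('o, 'a) category" and D :: "('p, 'b) category"
    and F :: "('o, 'a, 'p, 'b) cat_map" +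
  assumes obj_map_in: "A \<in> Obj C \<Longrightarrow> obj_map F A \<in> Obj D"
    and arr_map_in: "f \<in> Arr C \<Longrightarrow>
      arr_map F f \<in> hom D (obj_map F (Dom C f)) (obj_map F (Cod C f))"
    and arr_map_Idn: "A \<in> Obj C \<Longrightarrow> arr_map F (Idn C A) = Idn D (obj_map F A)"
    and arr_map_Comp: "f \<in> Arr C \<Longrightarrow> g \<in> Arr C \<Longrightarrow> Cod C f = Dom C g \<Longrightarrow>
      arr_map F (Comp C f g) = Comp D (arr_map F f) (arr_map F g)"

definition ULF :: "('o, 'a) category \<Rightarrow> ('p, 'b) category \<Rightarrow> ('o, 'a, 'p, 'b) cat_map \<Rightarrow> bool" where
  "ULF Q C F \<longleftrightarrow>
    (\<forall>\<alpha>\<in>Arr Q. \<forall>u\<in>Arr C. \<forall>v\<in>Arr C. Cod C u = Dom C v \<longrightarrow> arr_map F \<alpha> = Comp C u v \<longrightarrow>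
      (\<exists>!(\<beta>, \<gamma>). \<beta> \<in> Arr Q \<and> \<gamma> \<in> Arr Q \<and> Cod Q \<beta> = Dom Q \<gamma> \<and> \<alpha> = Comp Q \<beta> \<gamma> \<and>
        arr_map F \<beta> = u \<and> arr_map F \<gamma> = v))"

definition finitary :: "('o, 'a) category \<Rightarrow> ('p, 'b) category \<Rightarrow> ('o, 'a, 'p, 'b) cat_map \<Rightarrow> bool" where
  "finitary Q C F \<longleftrightarrow>
    (\<forall>A\<in>Obj C. finite {q \<in> Obj Q. obj_map F q = A}) \<and>
    (\<forall>w\<in>Arr C. finite {\<alpha> \<in> Arr Q. arr_map F \<alpha> = w})"


section \<open>Colored non-symmetric operads\<close>

text \<open>\<open>Subst P f [g\<^sub>1, \<dots>, g\<^sub>n]\<close> substitutes \<open>g\<^sub>i\<close> for the \<open>i\<close>-th input of the \<open>n\<close>-ary operation \<open>f\<close>.\<close>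

record ('c, 'f) operad =
  Col :: "'c set"
  Opn :: "'f set"
  Ins :: "'f \<Rightarrow> 'c list"
  Out :: "'f \<Rightarrow> 'c"
  Ident :: "'c \<Rightarrow> 'f"
  Subst :: "'f \<Rightarrow> 'f list \<Rightarrow> 'f"

definition composable :: "('c, 'f) operad \<Rightarrow> 'f \<Rightarrow> 'f list \<Rightarrow> bool" where
  "composable P f gs \<longleftrightarrow> f \<in> Opn P \<and> set gs \<subseteq> Opn P \<and> map (Out P) gs = Ins P f"

locale operad =
  fixes P :: "('c, 'f) operad"
  assumes Ins_in: "f \<in> Opn P \<Longrightarrow> set (Ins P f) \<subseteq> Col P"
    and Out_in: "f \<in> Opn P \<Longrightarrow> Out P f \<in> Col P"
    and Ident_in: "c \<in> Col P \<Longrightarrow> Ident P c \<in> Opn P"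
    and Ins_Ident: "c \<in> Col P \<Longrightarrow> Ins P (Ident P c) = [c]"
    and Out_Ident: "c \<in> Col P \<Longrightarrow> Out P (Ident P c) = c"
    and Subst_in: "composable P f gs \<Longrightarrow> Subst P f gs \<in> Opn P"
    and Ins_Subst: "composable P f gs \<Longrightarrow> Ins P (Subst P f gs) = concat (map (Ins P) gs)"
    and Out_Subst: "composable P f gs \<Longrightarrow> Out P (Subst P f gs) = Out P f"
    and Subst_Ident_left: "f \<in> Opn P \<Longrightarrow> Subst P (Ident P (Out P f)) [f] = f"
    and Subst_Ident_right: "f \<in> Opn P \<Longrightarrow> Subst P f (map (Ident P) (Ins P f)) = f"
    and Subst_assoc: "composable P f gs \<Longrightarrow> list_all2 (composable P) gs hss \<Longrightarrow>
      Subst P (Subst P f gs) (concat hss) = Subst P f (map2 (Subst P) gs hss)"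

text \<open>The constants \<open>\<alpha> : c\<close>.\<close>

definition constants :: "('c, 'f) operad \<Rightarrow> 'c \<Rightarrow> 'f set" where
  "constants P c = {\<alpha> \<in> Opn P. Ins P \<alpha> = [] \<and> Out P \<alpha> = c}"

record ('c, 'f, 'd, 'g) opd_map =
  col_map :: "'c \<Rightarrow> 'd"
  opn_map :: "'f \<Rightarrow> 'g"

definition opd_map_comp ::
  "('d, 'g, 'e, 'h) opd_map \<Rightarrow> ('c, 'f, 'd, 'g) opd_map \<Rightarrow> ('c, 'f, 'e, 'h) opd_map" where
  "opd_map_comp \<psi> \<phi> = \<lparr>col_map = col_map \<psi> \<circ> col_map \<phi>, opn_map = opn_map \<psi> \<circ> opn_map \<phi>\<rparr>"

locale opd_functor =
  source: operad P + target: operad R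
  for P :: "('c, 'f) operad" and R :: "('d, 'g) operad" and \<phi> :: "('c, 'f, 'd, 'g) opd_map" +
  assumes col_map_in: "c \<in> Col P \<Longrightarrow> col_map \<phi> c \<in> Col R"
    and opn_map_in: "f \<in> Opn P \<Longrightarrow> opn_map \<phi> f \<in> Opn R"
    and Ins_opn_map: "f \<in> Opn P \<Longrightarrow> Ins R (opn_map \<phi> f) = map (col_map \<phi>) (Ins P f)"
    and Out_opn_map: "f \<in> Opn P \<Longrightarrow> Out R (opn_map \<phi> f) = col_map \<phi> (Out P f)"
    and opn_map_Ident: "c \<in> Col P \<Longrightarrow> opn_map \<phi> (Ident P c) = Ident R (col_map \<phi> c)"
    and opn_map_Subst: "composable P f gs \<Longrightarrow>
      opn_map \<phi> (Subst P f gs) = Subst R (opn_map \<phi> f) (map (opn_map \<phi>) gs)"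


section \<open>Species and free operads\<close>

record ('c, 'x) species =
  Colors :: "'c set"
  Nodes :: "'x set"
  NIn :: "'x \<Rightarrow> 'c list"
  NOut :: "'x \<Rightarrow> 'c"

locale species =
  fixes S :: "('c, 'x) species"
  assumes NIn_in: "x \<in> Nodes S \<Longrightarrow> set (NIn S x) \<subseteq> Colors S"
    and NOut_in: "x \<in> Nodes S \<Longrightarrow> NOut S x \<in> Colors S"

definition finite_species :: "('c, 'x) species \<Rightarrow> bool" where
  "finite_species S \<longleftrightarrow> finite (Colors S) \<and> finite (Nodes S)"

text \<open>Operations of the free operad are well-typed planar trees of nodes; \<open>Leaf c\<close> is an
  open input of color \<open>c\<close>.  Substitution grafts trees onto the leaves, from left to right.\<close>

datatype ('c, 'x) tree = Leaf 'c | Node 'x "('c, 'x) tree list"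

fun leaves :: "('c, 'x) tree \<Rightarrow> 'c list" where
  "leaves (Leaf c) = [c]"
| "leaves (Node x ts) = concat (map leaves ts)"

fun root :: "('c, 'x) species \<Rightarrow> ('c, 'x) tree \<Rightarrow> 'c" where
  "root S (Leaf c) = c"
| "root S (Node x ts) = NOut S x"

inductive_set typed_trees :: "('c, 'x) species \<Rightarrow> ('c, 'x) tree set"
  for S :: "('c, 'x) species" where
  Leaf: "c \<in> Colors S \<Longrightarrow> Leaf c \<in> typed_trees S"
| Node: "x \<in> Nodes S \<Longrightarrow> \<forall>t\<in>set ts. t \<in> typed_trees S \<Longrightarrow> map (root S) ts = NIn S x \<Longrightarrow>
    Node x ts \<in> typed_trees S"

fun graft :: "('c, 'x) tree \<Rightarrow> ('c, 'x) tree list \<Rightarrow> ('c, 'x) tree"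
  and grafts :: "('c, 'x) tree list \<Rightarrow> ('c, 'x) tree list \<Rightarrow> ('c, 'x) tree list" where
  "graft (Leaf c) us = hd us"
| "graft (Node x ts) us = Node x (grafts ts us)"
| "grafts [] us = []"
| "grafts (t # ts) us =
    graft t (take (length (leaves t)) us) # grafts ts (drop (length (leaves t)) us)"

definition Free :: "('c, 'x) species \<Rightarrow> ('c, ('c, 'x) tree) operad" where
  "Free S = \<lparr>Col = Colors S, Opn = typed_trees S, Ins = leaves, Out = root S,
    Ident = Leaf, Subst = graft\<rparr>"

text \<open>The node \<open>x\<close> as an operation of the free operad.\<close>

definition corolla :: "('c, 'x) species \<Rightarrow> 'x \<Rightarrow> ('c, 'x) tree" where
  "corolla S x = Node x (map Leaf (NIn S x))"

text \<open>The functor out of the free operad determined by its values on colors and nodes.\<close>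

primrec eval_tree :: "('d, 'g) operad \<Rightarrow> ('c \<Rightarrow> 'd) \<Rightarrow> ('x \<Rightarrow> 'g) \<Rightarrow> ('c, 'x) tree \<Rightarrow> 'g" where
  "eval_tree P k v (Leaf c) = Ident P (k c)"
| "eval_tree P k v (Node x ts) = Subst P (v x) (map (eval_tree P k v) ts)"

definition free_extension ::
  "('d, 'g) operad \<Rightarrow> ('c \<Rightarrow> 'd) \<Rightarrow> ('x \<Rightarrow> 'g) \<Rightarrow> ('c, ('c, 'x) tree, 'd, 'g) opd_map" where
  "free_extension P k v = \<lparr>col_map = k, opn_map = eval_tree P k v\<rparr>"


section \<open>The operad of spliced arrows\<close>

text \<open>The spliced arrow \<open>w\<^sub>0 - \<dots> - w\<^sub>n\<close> is the nonempty list \<open>[w\<^sub>0, \<dots>, w\<^sub>n]\<close>.  Since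
  \<open>w\<^sub>i : B\<^sub>i \<rightarrow> A\<^sub>i\<^sub>+\<^sub>1\<close>, the colors can be read off from domains and codomains: the \<open>i\<close>-th input
  color \<open>(A\<^sub>i, B\<^sub>i)\<close> is the codomain of \<open>w\<^sub>i\<^sub>-\<^sub>1\<close> paired with the domain of \<open>w\<^sub>i\<close>, and the output
  color \<open>(A, B)\<close> is the domain of \<open>w\<^sub>0\<close> paired with the codomain of \<open>w\<^sub>n\<close>.\<close>

definition gaps :: "('o, 'a) category \<Rightarrow> 'a list \<Rightarrow> ('o \<times> 'o) list" where
  "gaps C ws = zip (map (Cod C) (butlast ws)) (map (Dom C) (tl ws))"

definition boundary :: "('o, 'a) category \<Rightarrow> 'a list \<Rightarrow> 'o \<times> 'o" where
  "boundary C ws = (Dom C (hd ws), Cod C (last ws))"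

text \<open>Juxtaposition composes the last arrow of \<open>us\<close> with the first arrow of \<open>vs\<close>; substitution
  of \<open>[g\<^sub>1, \<dots>, g\<^sub>n]\<close> is the juxtaposition \<open>w\<^sub>0 g\<^sub>1 w\<^sub>1 \<dots> g\<^sub>n w\<^sub>n\<close>.\<close>

definition juxt :: "('o, 'a) category \<Rightarrow> 'a list \<Rightarrow> 'a list \<Rightarrow> 'a list" where
  "juxt C us vs = butlast us @ [Comp C (last us) (hd vs)] @ tl vs"

fun fill_gaps :: "('o, 'a) category \<Rightarrow> 'a list \<Rightarrow> 'a list list \<Rightarrow> 'a list" where
  "fill_gaps C (w # ws) (g # gs) = juxt C [w] (juxt C g (fill_gaps C ws gs))"
| "fill_gaps C ws gs = ws"

definition Spliced :: "('o, 'a) category \<Rightarrow> ('o \<times> 'o, 'a list) operad" where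
  "Spliced C = \<lparr>Col = Obj C \<times> Obj C, Opn = {ws. ws \<noteq> [] \<and> set ws \<subseteq> Arr C},
    Ins = gaps C, Out = boundary C,
    Ident = (\<lambda>(A, B). [Idn C A, Idn C B]), Subst = fill_gaps C\<rparr>"

definition spliced_map ::
  "('o, 'a, 'p, 'b) cat_map \<Rightarrow> ('o \<times> 'o, 'a list, 'p \<times> 'p, 'b list) opd_map" where
  "spliced_map F = \<lparr>col_map = map_prod (obj_map F) (obj_map F), opn_map = map (arr_map F)\<rparr>"


section \<open>Context-free grammars of arrows\<close>

record ('o, 'a, 'c, 'x) grammar =
  g_cat :: "('o, 'a) category"
  g_species :: "('c, 'x) species"
  g_start :: "'c"
  g_functor :: "('c, ('c, 'x) tree, 'o \<times> 'o, 'a list) opd_map"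

locale cf_grammar =
  fixes G :: "('o, 'a, 'c, 'x) grammar"
  assumes g_category: "category (g_cat G)"
    and g_finitely_generated: "finitely_generated (g_cat G)"
    and g_species: "species (g_species G)"
    and g_finite_species: "finite_species (g_species G)"
    and g_start_in: "g_start G \<in> Colors (g_species G)"
    and g_opd_functor: "opd_functor (Free (g_species G)) (Spliced (g_cat G)) (g_functor G)"

text \<open>A constant of the operad of spliced arrows is a one-element list \<open>[w]\<close>, identified here
  with the arrow \<open>w\<close>.\<close>

definition language :: "('o, 'a, 'c, 'x) grammar \<Rightarrow> 'a set" where
  "language G =
    {w. \<exists>\<alpha> \<in> constants (Free (g_species G)) (g_start G). opn_map (g_functor G) \<alpha> = [w]}"

definition functorial_image ::
  "('p, 'b) category \<Rightarrow> ('o, 'a, 'p, 'b) cat_map \<Rightarrow> ('o, 'a, 'c, 'x) grammar \<Rightarrow>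
    ('p, 'b, 'c, 'x) grammar" where
  "functorial_image D F G = \<lparr>g_cat = D, g_species = g_species G, g_start = g_start G,
    g_functor = opd_map_comp (spliced_map F) (g_functor G)\<rparr>"


section \<open>Automata\<close>

record ('o, 'a, 's, 't) automaton =
  m_base :: "('o, 'a) category"
  m_cat :: "('s, 't) category"
  m_functor :: "('s, 't, 'o, 'a) cat_map"
  m_init :: "'s"
  m_final :: "'s"

locale nfa =
  fixes M :: "('o, 'a, 's, 't) automaton"
  assumes m_cat_functor: "cat_functor (m_cat M) (m_base M) (m_functor M)"
    and m_finitary: "finitary (m_cat M) (m_base M) (m_functor M)"
    and m_ULF: "ULF (m_cat M) (m_base M) (m_functor M)"
    and m_init_in: "m_init M \<in> Obj (m_cat M)"
    and m_final_in: "m_final M \<in> Obj (m_cat M)"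

definition nfa_language :: "('o, 'a, 's, 't) automaton \<Rightarrow> 'a set" where
  "nfa_language M = arr_map (m_functor M) ` hom (m_cat M) (m_init M) (m_final M)"


section \<open>The pullback grammar\<close>

text \<open>The colors of a pullback node \<open>(x, \<alpha>)\<close> are determined by those of \<open>x\<close> and \<open>\<alpha>\<close>; they lie
  over each other because \<open>x\<close> and \<open>\<alpha>\<close> have the same image (\<open>species_pullback\<close> below).\<close>

definition pullback_species ::
  "('o, 'a, 'c, 'x) grammar \<Rightarrow> ('o, 'a, 's, 't) automaton \<Rightarrow> ('s \<times> 'c \<times> 's, 'x \<times> 't list) species"
  where
  "pullback_species G M =
    \<lparr>Colors = {(q, R, q'). q \<in> Obj (m_cat M) \<and> R \<in> Colors (g_species G) \<and> q' \<in> Obj (m_cat M) \<and>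
        col_map (g_functor G) R = (obj_map (m_functor M) q, obj_map (m_functor M) q')},
     Nodes = {(x, \<alpha>). x \<in> Nodes (g_species G) \<and> \<alpha> \<in> Opn (Spliced (m_cat M)) \<and>
        opn_map (spliced_map (m_functor M)) \<alpha> =
          opn_map (g_functor G) (corolla (g_species G) x)},
     NIn = (\<lambda>(x, \<alpha>). map2 (\<lambda>(q, q') R. (q, R, q'))
        (Ins (Spliced (m_cat M)) \<alpha>) (NIn (g_species G) x)),
     NOut = (\<lambda>(x, \<alpha>). case Out (Spliced (m_cat M)) \<alpha> of (q, q') \<Rightarrow>
        (q, NOut (g_species G) x, q'))\<rparr>"

definition pullback_grammar ::
  "('o, 'a, 'c, 'x) grammar \<Rightarrow> ('o, 'a, 's, 't) automaton \<Rightarrow>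
    ('s, 't, 's \<times> 'c \<times> 's, 'x \<times> 't list) grammar" where
  "pullback_grammar G M =
    \<lparr>g_cat = m_cat M,
     g_species = pullback_species G M,
     g_start = (m_init M, g_start G, m_final M),
     g_functor = free_extension (Spliced (m_cat M)) (\<lambda>(q, R, q'). (q, q')) (\<lambda>(x, \<alpha>). \<alpha>)\<rparr>"


section \<open>Well-formedness\<close>

text \<open>The free operad and the operad of spliced arrows are operads, \<open>free_extension\<close> and
  \<open>spliced_map\<close> are functors of operads, and the pullback grammar and its functorial image
  are context-free grammars of arrows.\<close>

lemma juxt_simps:
  "juxt C [w] (v # vs) = Comp C w v # vs"
  "us \<noteq> [] \<Longrightarrow> juxt C (w # us) vs = w # juxt C us vs"
  by (auto simp: juxt_def)

lemma gaps_simps [simp]: "gaps C [w] = []" "gaps C (w # v # vs) = (Cod C w, Dom C v) # gaps C (v # vs)"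
  by (auto simp: gaps_def)

lemma gaps_Cons: "ws \<noteq> [] \<Longrightarrow> gaps C (w # ws) = (Cod C w, Dom C (hd ws)) # gaps C ws"
  by (cases ws) auto

lemma length_gaps: "length (gaps C ws) = length ws - 1"
  by (simp add: gaps_def)

context category begin

definition sp :: "'a list set" where "sp = {ws. ws \<noteq> [] \<and> set ws \<subseteq> Arr C}"

definition fits :: "'a list \<Rightarrow> 'a list \<Rightarrow> bool" where
  "fits us vs \<longleftrightarrow> us \<in> sp \<and> vs \<in> sp \<and> Cod C (last us) = Dom C (hd vs)"

lemma Comp_props:
  assumes "f \<in> Arr C" "g \<in> Arr C" "Cod C f = Dom C g"
  shows "Comp C f g \<in> Arr C" "Dom C (Comp C f g) = Dom C f" "Cod C (Comp C f g) = Cod C g"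
  using Comp_in[OF assms] by (auto simp: hom_def)

lemma juxt_props:
  assumes "fits us vs"
  shows "juxt C us vs \<in> sp \<and> Dom C (hd (juxt C us vs)) = Dom C (hd us)
    \<and> Cod C (last (juxt C us vs)) = Cod C (last vs)
    \<and> gaps C (juxt C us vs) = gaps C us @ gaps C vs"
  using assms
proof (induction us)
  case Nil then show ?case by (simp add: fits_def sp_def)
next
  case (Cons u us)
  obtain v vs' where v: "vs = v # vs'" using Cons.prems by (cases vs) (auto simp: fits_def sp_def)
  show ?case
  proof (cases "us = []")
    case True
    then show ?thesis using Cons.prems v
      by (cases vs') (auto simp: fits_def sp_def juxt_simps Comp_props)
  next
    case False
    have "fits us vs" using Cons.prems False by (auto simp: fits_def sp_def)
    with Cons.IH have IH: "juxt C us vs \<in> sp \<and> Dom C (hd (juxt C us vs)) = Dom C (hd us)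
    \<and> Cod C (last (juxt C us vs)) = Cod C (last vs)
    \<and> gaps C (juxt C us vs) = gaps C us @ gaps C vs" by simp
    then have "juxt C us vs \<noteq> []" by (auto simp: sp_def)
    with IH False Cons.prems show ?thesis
      by (auto simp: juxt_simps gaps_Cons) (auto simp: fits_def sp_def)
  qed
qed

lemma fits_juxt_left: "fits us vs \<Longrightarrow> fits (juxt C us vs) xs \<longleftrightarrow> fits vs xs"
  using juxt_props[of us vs] by (auto simp: fits_def)

lemma fits_juxt_right: "fits us vs \<Longrightarrow> fits xs (juxt C us vs) \<longleftrightarrow> fits xs us"
  using juxt_props[of us vs] by (auto simp: fits_def)

lemma juxt_assoc:
  assumes "fits us vs" "fits vs xs"
  shows "juxt C (juxt C us vs) xs = juxt C us (juxt C vs xs)"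
  using assms(1)
proof (induction us)
  case Nil then show ?case by (simp add: fits_def sp_def)
next
  case (Cons u us)
  obtain v vs' where v: "vs = v # vs'" using Cons.prems by (cases vs) (auto simp: fits_def sp_def)
  obtain x xs' where x: "xs = x # xs'" using assms by (cases xs) (auto simp: fits_def sp_def)
  show ?case
  proof (cases "us = []")
    case True
    show ?thesis
    proof (cases "vs' = []")
      case False with True v show ?thesis by (simp add: juxt_simps)
    next
      case 2: True
      with True v x Cons.prems assms(2) show ?thesis
        by (auto simp: juxt_simps fits_def sp_def Comp_assoc)
    qed
  next
    case False
    have f: "fits us vs" using Cons.prems False by (auto simp: fits_def sp_def)
    have "juxt C us vs \<noteq> []" using juxt_props[OF f] by (auto simp: sp_def)
    with Cons.IH[OF f] False show ?thesis by (simp add: juxt_simps)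
  qed
qed

lemma composable_Spliced:
  "composable (Spliced C) ws gs \<longleftrightarrow>
     ws \<in> sp \<and> set gs \<subseteq> sp \<and> map (boundary C) gs = gaps C ws"
  by (auto simp: composable_def Spliced_def sp_def)

lemma composable_Nil: "composable (Spliced C) ws [] \<longleftrightarrow> (\<exists>w\<in>Arr C. ws = [w])"
  by (cases ws; cases "tl ws") (auto simp: composable_Spliced sp_def)

lemma composable_Cons: "composable (Spliced C) ws (g # gs) \<longleftrightarrow>
   (\<exists>w ws'. ws = w # ws' \<and> w \<in> Arr C \<and> fits [w] g \<and> fits g ws' \<and> composable (Spliced C) ws' gs)"
proof (cases ws)
  case Nil then show ?thesis by (auto simp: composable_Spliced sp_def)
next
  case (Cons w ws')
  then show ?thesis
    by (cases ws') (auto simp: composable_Spliced sp_def fits_def boundary_def)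
qed

lemma fill_props:
  assumes "composable (Spliced C) ws gs"
  shows "fill_gaps C ws gs \<in> sp \<and> Dom C (hd (fill_gaps C ws gs)) = Dom C (hd ws) \<and>
    Cod C (last (fill_gaps C ws gs)) = Cod C (last ws) \<and>
    gaps C (fill_gaps C ws gs) = concat (map (gaps C) gs)"
  using assms
proof (induction gs arbitrary: ws)
  case Nil
  then show ?case by (auto simp: composable_Nil sp_def)
next
  case (Cons g gs)
  then obtain w ws' where ws: "ws = w # ws'" and f: "w \<in> Arr C" "fits [w] g" "fits g ws'"
    "composable (Spliced C) ws' gs" by (auto simp: composable_Cons)
  note IH = Cons.IH[OF f(4)]
  have a: "fits g (fill_gaps C ws' gs)" using IH f(3) by (auto simp: fits_def)
  have b: "fits [w] (juxt C g (fill_gaps C ws' gs))" using a f(2) by (simp add: fits_juxt_right)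
  show ?case using juxt_props[OF a] juxt_props[OF b] IH f(3) by (auto simp: ws fits_def sp_def)
qed

lemma fill_juxt:
  assumes "fits us vs" "composable (Spliced C) us gs" "composable (Spliced C) vs hs"
  shows "fill_gaps C (juxt C us vs) (gs @ hs) = juxt C (fill_gaps C us gs) (fill_gaps C vs hs)"
  using assms(1,2)
proof (induction gs arbitrary: us)
  case Nil
  then obtain w where us: "us = [w]" "w \<in> Arr C" by (auto simp: composable_Nil)
  show ?case
  proof (cases hs)
    case Nil2: Nil
    then obtain v where "vs = [v]" using assms(3) by (auto simp: composable_Nil)
    then show ?thesis using us Nil2 by (simp add: juxt_simps)
  next
    case (Cons h hs')
    obtain v vs' where vs: "vs = v # vs'" and f: "v \<in> Arr C" "fits [v] h" "fits h vs'"
      "composable (Spliced C) vs' hs'" using assms(3) Cons by (auto simp: composable_Cons)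
    note P = fill_props[OF f(4)]
    have a: "fits h (fill_gaps C vs' hs')" using P f(3) by (auto simp: fits_def)
    have b: "fits [v] (juxt C h (fill_gaps C vs' hs'))" using a f(2) by (simp add: fits_juxt_right)
    have "fits [w] [v]" using Nil.prems(1) us vs f by (auto simp: fits_def sp_def)
    from juxt_assoc[OF this b] show ?thesis
      by (simp add: us vs Cons juxt_simps)
  qed
next
  case (Cons g gs)
  then obtain w us' where us: "us = w # us'" and f: "w \<in> Arr C" "fits [w] g" "fits g us'"
    "composable (Spliced C) us' gs" by (auto simp: composable_Cons)
  have n: "us' \<noteq> []" using f(3) by (auto simp: fits_def sp_def)
  have f1: "fits us' vs" using Cons.prems(1) us n f(3) by (auto simp: fits_def sp_def)
  note IH = Cons.IH[OF f1 f(4)]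
  note P = fill_props[OF f(4)] and Q = fill_props[OF assms(3)]
  let ?U = "fill_gaps C us' gs" and ?V = "fill_gaps C vs hs"
  have a: "fits g ?U" using P f(3) by (auto simp: fits_def)
  have b: "fits [w] (juxt C g ?U)" using a f(2) by (simp add: fits_juxt_right)
  have c: "fits ?U ?V" using P Q f1 by (auto simp: fits_def)
  have d: "fits (juxt C g ?U) ?V" using fits_juxt_left[OF a] c by simp
  show ?case
    using n by (simp add: us juxt_simps IH juxt_assoc[OF b d] juxt_assoc[OF a c])
qed

lemma fill_assoc:
  assumes "composable (Spliced C) f gs" "list_all2 (composable (Spliced C)) gs hss"
  shows "fill_gaps C (fill_gaps C f gs) (concat hss) = fill_gaps C f (map2 (fill_gaps C) gs hss)"
  using assms
proof (induction gs arbitrary: f hss)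
  case Nil
  then show ?case by (auto simp: composable_Nil)
next
  case (Cons g gs)
  then obtain w ws' where ws: "f = w # ws'" and f: "w \<in> Arr C" "fits [w] g" "fits g ws'"
    "composable (Spliced C) ws' gs" by (auto simp: composable_Cons)
  obtain hs hss' where h: "hss = hs # hss'" "composable (Spliced C) g hs"
    "list_all2 (composable (Spliced C)) gs hss'" using Cons.prems by (auto simp: list_all2_Cons1)
  note IH = Cons.IH[OF f(4) h(3)]
  let ?U = "fill_gaps C ws' gs"
  note P = fill_props[OF f(4)]
  have a: "fits g ?U" using P f(3) by (auto simp: fits_def)
  have b: "fits [w] (juxt C g ?U)" using a f(2) by (simp add: fits_juxt_right)
  have m: "set gs \<subseteq> sp" using f(4) by (auto simp: composable_Spliced)
  have "map (boundary C) (concat hss') = concat (map (gaps C) gs)" 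
    using h(3) by (induction gs hss' rule: list_all2_induct) (auto simp: composable_Spliced)
  moreover have "set (concat hss') \<subseteq> sp"
    using h(3) by (induction gs hss' rule: list_all2_induct) (auto simp: composable_Spliced)
  ultimately have cU: "composable (Spliced C) ?U (concat hss')"
    using P by (auto simp: composable_Spliced)
  have cJ: "composable (Spliced C) (juxt C g ?U) (hs @ concat hss')"
    using cU h(2) juxt_props[OF a] by (auto simp: composable_Spliced)
  have cw: "composable (Spliced C) [w] []" using f by (simp add: composable_Nil)
  show ?case
    using fill_juxt[OF b cw cJ] fill_juxt[OF a h(2) cU] IH by (simp add: ws h)
qed

lemma fill_Idn_right:
  assumes "ws \<in> sp"
  shows "fill_gaps C ws (map (Ident (Spliced C)) (gaps C ws)) = ws"
  using assms
proof (induction ws)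
  case Nil then show ?case by simp
next
  case (Cons w ws)
  show ?case
  proof (cases ws)
    case Nil then show ?thesis by simp
  next
    case (Cons v vs)
    then have "fill_gaps C (v # vs) (map (Ident (Spliced C)) (gaps C (v # vs))) = v # vs"
      using Cons.IH Cons.prems by (simp add: sp_def)
    then show ?thesis using Cons Cons.prems
      by (simp add: juxt_simps sp_def Spliced_def Comp_Idn_left Comp_Idn_right)
  qed
qed

lemma operad_Spliced: "operad (Spliced C)"
proof
  fix f assume "f \<in> Opn (Spliced C)"
  then have f: "f \<in> sp" by (simp add: Spliced_def sp_def)
  show "set (Ins (Spliced C) f) \<subseteq> Col (Spliced C)"
  proof -
    have "set (butlast f) \<subseteq> Arr C" "set (tl f) \<subseteq> Arr C"
      using f by (cases f; auto simp: sp_def dest: in_set_butlastD)+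
    then show ?thesis
      using Dom_in Cod_in by (auto simp: Spliced_def gaps_def subset_iff elim!: in_set_zipE)
  qed
  show "Out (Spliced C) f \<in> Col (Spliced C)"
    using f Dom_in Cod_in by (auto simp: Spliced_def sp_def boundary_def subset_iff)
  show "Subst (Spliced C) f (map (Ident (Spliced C)) (Ins (Spliced C) f)) = f"
    using fill_Idn_right[OF f] by (simp add: Spliced_def)
  show "Subst (Spliced C) (Ident (Spliced C) (Out (Spliced C) f)) [f] = f"
  proof -
    have l: "juxt C [Idn C (Dom C (hd f))] f = f"
      using f by (cases f) (auto simp: sp_def juxt_simps Comp_Idn_left)
    have "juxt C f [Idn C (Cod C (last f))] = f"
      using f by (auto simp: sp_def juxt_def Comp_Idn_right subset_iff)
    with l show ?thesis by (simp add: Spliced_def boundary_def)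
  qed
next
  fix c assume "c \<in> Col (Spliced C)"
  then obtain A B where c: "c = (A, B)" "A \<in> Obj C" "B \<in> Obj C" by (auto simp: Spliced_def)
  then show "Ident (Spliced C) c \<in> Opn (Spliced C)" "Ins (Spliced C) (Ident (Spliced C) c) = [c]"
    "Out (Spliced C) (Ident (Spliced C) c) = c"
    using Idn_in by (auto simp: Spliced_def hom_def boundary_def)
next
  fix f gs assume "composable (Spliced C) f gs"
  note P = fill_props[OF this]
  show "Subst (Spliced C) f gs \<in> Opn (Spliced C)" using P by (simp add: Spliced_def sp_def)
  show "Ins (Spliced C) (Subst (Spliced C) f gs) = concat (map (Ins (Spliced C)) gs)"
    using P by (simp add: Spliced_def)
  show "Out (Spliced C) (Subst (Spliced C) f gs) = Out (Spliced C) f"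
    using P by (simp add: Spliced_def boundary_def)
next
  fix f gs hss assume "composable (Spliced C) f gs" "list_all2 (composable (Spliced C)) gs hss"
  from fill_assoc[OF this]
  show "Subst (Spliced C) (Subst (Spliced C) f gs) (concat hss) = Subst (Spliced C) f (map2 (Subst (Spliced C)) gs hss)"
    by (simp add: Spliced_def)
qed

end

lemma leaves_graft:
  "length us = length (leaves t) \<Longrightarrow> leaves (graft t us) = concat (map leaves us)"
  "length us = length (concat (map leaves ts)) \<Longrightarrow>
    concat (map leaves (grafts ts us)) = concat (map leaves us)"
proof (induction t us and ts us rule: graft_grafts.induct)
  case (1 c us) then show ?case by (cases us) auto
next
  case (4 t ts us)
  have "leaves (graft t (take (length (leaves t)) us)) = concat (map leaves (take (length (leaves t)) us))"
    using 4 by simp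
  moreover have "concat (map leaves (grafts ts (drop (length (leaves t)) us))) = concat (map leaves (drop (length (leaves t)) us))"
    using 4 by simp
  ultimately show ?case by (simp flip: concat_append map_append)
qed auto

lemma length_grafts: "length (grafts ts us) = length ts"
  by (induction ts arbitrary: us) auto



lemma grafts_Leaf:
  assumes "\<And>t. t \<in> set ts \<Longrightarrow> graft t (map Leaf (leaves t)) = t"
  shows "grafts ts (map Leaf (concat (map leaves ts))) = ts"
  using assms by (induction ts) (auto simp: take_map drop_map)

lemma graft_Leaf: "graft t (map Leaf (leaves t)) = t"
  by (induction t) (auto simp: grafts_Leaf)

lemma graft_assoc:
  "length gs = length (leaves t) \<Longrightarrow> list_all2 (\<lambda>g hs. length hs = length (leaves g)) gs hss \<Longrightarrow>
    graft (graft t gs) (concat hss) = graft t (map2 graft gs hss)"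
  "length gs = length (concat (map leaves ts)) \<Longrightarrow> list_all2 (\<lambda>g hs. length hs = length (leaves g)) gs hss \<Longrightarrow>
    grafts (grafts ts gs) (concat hss) = grafts ts (map2 graft gs hss)"
proof (induction t gs and ts gs arbitrary: hss and hss rule: graft_grafts.induct)
  case (1 c us) then show ?case by (cases us; cases hss) auto
next
  case (4 t ts us)
  let ?n = "length (leaves t)"
  have s: "hss = take ?n hss @ drop ?n hss" by simp
  have L: "list_all2 (\<lambda>g hs. length hs = length (leaves g)) (take ?n us) (take ?n hss)"
       "list_all2 (\<lambda>g hs. length hs = length (leaves g)) (drop ?n us) (drop ?n hss)"
    using 4(4) by (auto intro: list_all2_takeI list_all2_dropI)
  have l: "length (leaves (graft t (take ?n us))) = length (concat (take ?n hss))"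
  proof -
    have "leaves (graft t (take ?n us)) = concat (map leaves (take ?n us))"
      using 4(3) by (intro leaves_graft) simp
    moreover have "length (concat (map leaves (take ?n us))) = length (concat (take ?n hss))"
      using L(1) by (induction rule: list_all2_induct) auto
    ultimately show ?thesis by simp
  qed
  have c: "concat hss = concat (take ?n hss) @ concat (drop ?n hss)"
    by (metis s concat_append)
  show ?case using 4(1)[OF _ L(1)] 4(2)[OF _ L(2)] 4(3) l
    by (simp add: c take_map drop_map take_zip drop_zip)
qed auto

lemma root_in: "species S \<Longrightarrow> t \<in> typed_trees S \<Longrightarrow> root S t \<in> Colors S"
  by (erule typed_trees.cases) (auto simp: species.NOut_in)

lemma leaves_in: "t \<in> typed_trees S \<Longrightarrow> set (leaves t) \<subseteq> Colors S"
  by (induction rule: typed_trees.induct) auto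

lemma graft_typed:
  "t \<in> typed_trees S \<Longrightarrow> set us \<subseteq> typed_trees S \<Longrightarrow> map (root S) us = leaves t \<Longrightarrow>
    graft t us \<in> typed_trees S \<and> root S (graft t us) = root S t"
  "set ts \<subseteq> typed_trees S \<Longrightarrow> set us \<subseteq> typed_trees S \<Longrightarrow> map (root S) us = concat (map leaves ts) \<Longrightarrow>
    set (grafts ts us) \<subseteq> typed_trees S \<and> map (root S) (grafts ts us) = map (root S) ts"
proof (induction t us and ts us rule: graft_grafts.induct)
  case (1 c us) then show ?case by (cases us) auto
next
  case (2 x ts us)
  from 2(2) have x: "x \<in> Nodes S" "set ts \<subseteq> typed_trees S" "map (root S) ts = NIn S x"
    by (auto elim: typed_trees.cases)
  from 2(1)[OF x(2) 2(3)] 2(4) x show ?case by (auto intro!: typed_trees.Node)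
next
  case (4 t ts us)
  have m: "map (root S) (take (length (leaves t)) us) = leaves t" 
    "map (root S) (drop (length (leaves t)) us) = concat (map leaves ts)"
    using 4(5) by (simp_all flip: take_map drop_map)
  have "set (take (length (leaves t)) us) \<subseteq> typed_trees S" "set (drop (length (leaves t)) us) \<subseteq> typed_trees S"
    using 4(4) by (auto dest: in_set_takeD in_set_dropD)
  then show ?case using 4(1,2,3) m by simp
qed auto

lemma operad_Free:
  assumes "species S" shows "operad (Free S)"
proof
  interpret species S by fact
  fix f gs hss assume c: "composable (Free S) f gs" "list_all2 (composable (Free S)) gs hss"
  have "list_all2 (\<lambda>g hs. length hs = length (leaves g)) gs hss"
    using c(2) by (rule list_all2_mono) (auto simp: composable_def Free_def dest: arg_cong[where f=length])
  then show "Subst (Free S) (Subst (Free S) f gs) (concat hss) = Subst (Free S) f (map2 (Subst (Free S)) gs hss)"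
    using c(1) by (auto simp: composable_def Free_def dest: arg_cong[where f=length] intro!: graft_assoc)
next
  fix f gs assume "composable (Free S) f gs"
  then have c: "f \<in> typed_trees S" "set gs \<subseteq> typed_trees S" "map (root S) gs = leaves f"
    by (auto simp: composable_def Free_def)
  have l: "length gs = length (leaves f)" using c(3) by (metis length_map)
  show "Subst (Free S) f gs \<in> Opn (Free S)" "Out (Free S) (Subst (Free S) f gs) = Out (Free S) f"
   "Ins (Free S) (Subst (Free S) f gs) = concat (map (Ins (Free S)) gs)"
    using graft_typed(1)[OF c] leaves_graft(1)[OF l] by (auto simp: Free_def)
qed (use root_in[OF assms] leaves_in in \<open>auto simp: Free_def graft_Leaf intro: typed_trees.Leaf\<close>)

lemma Out_eval: 
  assumes "operad P" "\<And>c. c \<in> Colors S \<Longrightarrow> k c \<in> Col P"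
    "\<And>x. x \<in> Nodes S \<Longrightarrow> v x \<in> Opn P \<and> Ins P (v x) = map k (NIn S x) \<and> Out P (v x) = k (NOut S x)"
    "t \<in> typed_trees S"
  shows "eval_tree P k v t \<in> Opn P \<and> Out P (eval_tree P k v t) = k (root S t) \<and>
     Ins P (eval_tree P k v t) = map k (leaves t) \<and>
     (\<forall>x ts. t = Node x ts \<longrightarrow> composable P (v x) (map (eval_tree P k v) ts))"
  using assms(4)
proof induction
  case (Leaf c)
  interpret operad P by fact
  show ?case using Leaf assms(2) by (simp add: Ident_in Ins_Ident Out_Ident)
next
  case (Node x ts)
  interpret operad P by fact
  have x: "x \<in> Nodes S" and r: "map (root S) ts = NIn S x" using Node by auto
  have IH: "eval_tree P k v t \<in> Opn P \<and> Out P (eval_tree P k v t) = k (root S t) \<and>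
     Ins P (eval_tree P k v t) = map k (leaves t)" if "t \<in> set ts" for t
    using Node that by blast
  note v = assms(3)[OF x]
  have "map (Out P) (map (eval_tree P k v) ts) = map k (map (root S) ts)" using IH by simp
  then have c: "composable P (v x) (map (eval_tree P k v) ts)"
    unfolding r composable_def using IH v by auto
  have "concat (map (\<lambda>t. Ins P (eval_tree P k v t)) ts) = concat (map (\<lambda>t. map k (leaves t)) ts)"
    using IH by (auto intro!: arg_cong[of _ _ concat])
  then show ?case using c v
    by (simp add: Subst_in Ins_Subst Out_Subst map_concat o_def)
qed

lemma eval_graft:
  fixes S :: "('c,'x) species"
  assumes "operad P" "\<And>c. c \<in> Colors S \<Longrightarrow> k c \<in> Col P"
    "\<And>x. x \<in> Nodes S \<Longrightarrow> v x \<in> Opn P \<and> Ins P (v x) = map k (NIn S x) \<and> Out P (v x) = k (NOut S x)"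
  shows
  "t \<in> typed_trees S \<Longrightarrow> set us \<subseteq> typed_trees S \<Longrightarrow> map (root S) us = leaves t \<Longrightarrow>
    eval_tree P k v (graft t us) = Subst P (eval_tree P k v t) (map (eval_tree P k v) us)"
  "set ts \<subseteq> typed_trees S \<Longrightarrow> set us \<subseteq> typed_trees S \<Longrightarrow> map (root S) us = concat (map leaves ts) \<Longrightarrow>
    \<exists>uss. us = concat uss \<and> list_all2 (\<lambda>t us. map (root S) us = leaves t) ts uss \<and>
       map (eval_tree P k v) (grafts ts us) = map2 (\<lambda>t us. Subst P (eval_tree P k v t) (map (eval_tree P k v) us)) ts uss"
proof (induction t us and ts us rule: graft_grafts.induct)
  case (1 c us)
  interpret operad P by fact
  from 1 obtain u where u: "us = [u]" "u \<in> typed_trees S" "root S u = c" by (cases us) auto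
  with Out_eval[OF assms u(2)] Subst_Ident_left[of "eval_tree P k v u"] show ?case by simp
next
  case (2 x ts us)
  interpret operad P by fact
  have ts: "set ts \<subseteq> typed_trees S" using 2(2) by (auto elim: typed_trees.cases)
  from 2(1)[OF ts 2(3)] 2(4) obtain uss where u: "us = concat uss" "list_all2 (\<lambda>t us. map (root S) us = leaves t) ts uss"
    "map (eval_tree P k v) (grafts ts us) = map2 (\<lambda>t us. Subst P (eval_tree P k v t) (map (eval_tree P k v) us)) ts uss"
    by auto
  let ?e = "eval_tree P k v"
  have c: "composable P (v x) (map ?e ts)" using Out_eval[OF assms 2(2)] by simp
  have "list_all2 (composable P) (map ?e ts) (map (map ?e) uss)"
    unfolding list_all2_map1 list_all2_map2
  proof (rule list_all2I, clarify)
    fix t w assume z: "(t, w) \<in> set (zip ts uss)"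
    have t: "t \<in> typed_trees S" using ts z by (auto dest: set_zip_leftD)
    have w: "set w \<subseteq> typed_trees S" using 2(3) u(1) z by (auto dest: set_zip_rightD)
    have m: "map (root S) w = leaves t" using u(2) z by (auto simp: list_all2_iff)
    have "map (Out P) (map ?e w) = map k (map (root S) w)" using w Out_eval[OF assms] by auto
    then show "composable P (?e t) (map ?e w)"
      using Out_eval[OF assms t] m w Out_eval[OF assms] by (auto simp: composable_def)
  qed (use u(2) in \<open>auto simp: list_all2_lengthD\<close>)
  from Subst_assoc[OF c this] show ?case
    using u by (simp add: map_concat zip_map1 zip_map2 o_def case_prod_unfold)
next
  case (3 us) then show ?case by (intro exI[of _ "[]"]) auto
next
  case (4 t ts us)
  have m: "map (root S) (take (length (leaves t)) us) = leaves t" 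
    "map (root S) (drop (length (leaves t)) us) = concat (map leaves ts)"
    using 4(5) by (simp_all flip: take_map drop_map)
  have s: "set (take (length (leaves t)) us) \<subseteq> typed_trees S" "set (drop (length (leaves t)) us) \<subseteq> typed_trees S"
    using 4(4) by (auto dest: in_set_takeD in_set_dropD)
  from 4(2)[OF _ s(2) m(2)] 4(3) obtain uss where
     u: "drop (length (leaves t)) us = concat uss" "list_all2 (\<lambda>t us. map (root S) us = leaves t) ts uss"
    "map (eval_tree P k v) (grafts ts (drop (length (leaves t)) us)) = map2 (\<lambda>t us. Subst P (eval_tree P k v t) (map (eval_tree P k v) us)) ts uss"
    by auto
  show ?case using 4(1)[OF _ s(1) m(1)] 4(3) u m
    by (intro exI[of _ "take (length (leaves t)) us # uss"]) (simp flip: u(1))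
qed

lemma opd_functor_free_extension:
  assumes "species S" "operad P" "\<And>c. c \<in> Colors S \<Longrightarrow> k c \<in> Col P"
    "\<And>x. x \<in> Nodes S \<Longrightarrow> v x \<in> Opn P \<and> Ins P (v x) = map k (NIn S x) \<and> Out P (v x) = k (NOut S x)"
  shows "opd_functor (Free S) P (free_extension P k v)"
proof -
  interpret source: operad "Free S" using assms(1) by (rule operad_Free)
  interpret target: operad P by fact
  show ?thesis
    by unfold_locales
     (use Out_eval[OF assms(2-4)] eval_graft(1)[OF assms(2-4)] assms(3) in \<open>auto simp: Free_def free_extension_def composable_def\<close>)
qed

lemma eval_tree_corolla:
  assumes "operad P" "v x \<in> Opn P" "Ins P (v x) = map k (NIn S x)"
  shows "eval_tree P k v (corolla S x) = v x"
proof -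
  interpret operad P by fact
  show ?thesis using Subst_Ident_right[OF assms(2)] assms(3) by (simp add: corolla_def o_def)
qed

context cat_functor begin

lemma arr_map_props:
  assumes "f \<in> Arr C"
  shows "arr_map F f \<in> Arr D" "Dom D (arr_map F f) = obj_map F (Dom C f)"
    "Cod D (arr_map F f) = obj_map F (Cod C f)"
  using arr_map_in[OF assms] by (auto simp: hom_def)

lemma gaps_map: "ws \<in> source.sp \<Longrightarrow>
  gaps D (map (arr_map F) ws) = map (map_prod (obj_map F) (obj_map F)) (gaps C ws)"
proof (induction ws)
  case (Cons w ws)
  then show ?case by (cases ws) (auto simp: arr_map_props source.sp_def)
qed (simp add: gaps_def)

lemma boundary_map: "ws \<in> source.sp \<Longrightarrow>
  boundary D (map (arr_map F) ws) = map_prod (obj_map F) (obj_map F) (boundary C ws)"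
  by (auto simp: boundary_def source.sp_def hd_map last_map arr_map_props subset_iff)

lemma juxt_map:
  assumes "source.fits us vs"
  shows "map (arr_map F) (juxt C us vs) = juxt D (map (arr_map F) us) (map (arr_map F) vs)"
proof -
  have n: "us \<noteq> []" "vs \<noteq> []" "last us \<in> Arr C" "hd vs \<in> Arr C" "Cod C (last us) = Dom C (hd vs)"
    using assms by (auto simp: source.fits_def source.sp_def)
  then show ?thesis by (simp add: juxt_def arr_map_Comp hd_map last_map map_butlast map_tl)
qed

lemma fill_gaps_map:
  assumes "composable (Spliced C) ws gs"
  shows "map (arr_map F) (fill_gaps C ws gs) = fill_gaps D (map (arr_map F) ws) (map (map (arr_map F)) gs)"
  using assms
proof (induction gs arbitrary: ws)
  case Nil then show ?case by (auto simp: source.composable_Nil)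
next
  case (Cons g gs)
  then obtain w ws' where ws: "ws = w # ws'" and f: "w \<in> Arr C" "source.fits [w] g" "source.fits g ws'"
    "composable (Spliced C) ws' gs" by (auto simp: source.composable_Cons)
  note IH = source.fill_props[OF f(4)]
  have a: "source.fits g (fill_gaps C ws' gs)" using IH f(3) by (auto simp: source.fits_def)
  have b: "source.fits [w] (juxt C g (fill_gaps C ws' gs))" using a f(2) by (simp add: source.fits_juxt_right)
  show ?case by (simp add: ws juxt_map[OF a] juxt_map[OF b] Cons.IH[OF f(4)])
qed

lemma opd_functor_spliced_map: "opd_functor (Spliced C) (Spliced D) (spliced_map F)"
proof -
  interpret S: operad "Spliced C" by (rule source.operad_Spliced)
  interpret T: operad "Spliced D" by (rule target.operad_Spliced)
  show ?thesis
  proof unfold_locales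
    fix f assume "f \<in> Opn (Spliced C)"
    then have f: "f \<in> source.sp" by (simp add: Spliced_def source.sp_def)
    show "opn_map (spliced_map F) f \<in> Opn (Spliced D)"
      using f by (auto simp: Spliced_def spliced_map_def source.sp_def arr_map_props subset_iff)
    show "Ins (Spliced D) (opn_map (spliced_map F) f) = map (col_map (spliced_map F)) (Ins (Spliced C) f)"
      using gaps_map[OF f] by (simp add: Spliced_def spliced_map_def)
    show "Out (Spliced D) (opn_map (spliced_map F) f) = col_map (spliced_map F) (Out (Spliced C) f)"
      using boundary_map[OF f] by (simp add: Spliced_def spliced_map_def)
  next
    fix f gs assume "composable (Spliced C) f gs"
    from fill_gaps_map[OF this]
    show "opn_map (spliced_map F) (Subst (Spliced C) f gs) = Subst (Spliced D) (opn_map (spliced_map F) f) (map (opn_map (spliced_map F)) gs)"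
      by (simp add: Spliced_def spliced_map_def)
  qed (auto simp: Spliced_def spliced_map_def arr_map_Idn obj_map_in)
qed

end

lemma opd_functor_comp:
  assumes "opd_functor P R \<phi>" "opd_functor R T \<psi>"
  shows "opd_functor P T (opd_map_comp \<psi> \<phi>)"
proof -
  interpret A: opd_functor P R \<phi> by fact
  interpret B: opd_functor R T \<psi> by fact
  show ?thesis
  proof unfold_locales
    fix f gs assume c: "composable P f gs"
    have "set gs \<subseteq> Opn P" using c by (simp add: composable_def)
    then have "map (Out R) (map (opn_map \<phi>) gs) = map (col_map \<phi>) (map (Out P) gs)"
      by (simp add: A.Out_opn_map subset_iff)
    then have "composable R (opn_map \<phi> f) (map (opn_map \<phi>) gs)"
      using c A.opn_map_in unfolding composable_def by (auto simp add: A.Ins_opn_map simp del: map_map)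
    then show "opn_map (opd_map_comp \<psi> \<phi>) (Subst P f gs) =
       Subst T (opn_map (opd_map_comp \<psi> \<phi>) f) (map (opn_map (opd_map_comp \<psi> \<phi>)) gs)"
      using c by (simp add: opd_map_comp_def A.opn_map_Subst B.opn_map_Subst)
  qed (auto simp: opd_map_comp_def A.col_map_in B.col_map_in A.opn_map_in B.opn_map_in A.Ins_opn_map B.Ins_opn_map
       A.Out_opn_map B.Out_opn_map A.opn_map_Ident B.opn_map_Ident)
qed

lemma cf_grammar_functorial_image:
  assumes "cf_grammar G" "cat_functor (g_cat G) D F" "finitely_generated D"
  shows "cf_grammar (functorial_image D F G)"
proof -
  interpret cf_grammar G by fact
  interpret cat_functor "g_cat G" D F by fact
  show ?thesis
    by (rule cf_grammar.intro)
      (use assms(3) g_species g_finite_species g_start_in opd_functor_comp[OF g_opd_functor opd_functor_spliced_map]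
        target.category_axioms in \<open>auto simp: functorial_image_def\<close>)
qed

locale grammar_nfa = cf_grammar G + nfa M
  for G :: "('o, 'a, 'c, 'x) grammar" and M :: "('o, 'a, 's, 't) automaton" +
  assumes base: "m_base M = g_cat G"
begin

abbreviation "Q \<equiv> m_cat M"
abbreviation "C \<equiv> g_cat G"
abbreviation "F \<equiv> m_functor M"
abbreviation "S \<equiv> g_species G"
abbreviation "p \<equiv> g_functor G"

sublocale F: cat_functor Q C F using m_cat_functor base by simp
sublocale S: species S by (rule g_species)
sublocale p: opd_functor "Free S" "Spliced C" p by (rule g_opd_functor)
sublocale WF: opd_functor "Spliced Q" "Spliced C" "spliced_map F" by (rule F.opd_functor_spliced_map)

lemma corolla_in: "x \<in> Nodes S \<Longrightarrow> corolla S x \<in> Opn (Free S)"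
  using S.NIn_in[of x] by (auto simp: corolla_def Free_def o_def intro!: typed_trees.Node typed_trees.Leaf)

lemma corolla_io: "Ins (Free S) (corolla S x) = NIn S x" "Out (Free S) (corolla S x) = NOut S x"
  by (simp_all add: corolla_def Free_def o_def)

lemma node_pullback:
  assumes "(x, \<alpha>) \<in> Nodes (pullback_species G M)"
  shows "x \<in> Nodes S" "\<alpha> \<in> Opn (Spliced Q)"
    "opn_map (spliced_map F) \<alpha> = opn_map p (corolla S x)"
    "map (map_prod (obj_map F) (obj_map F)) (Ins (Spliced Q) \<alpha>) = map (col_map p) (NIn S x)"
    "map_prod (obj_map F) (obj_map F) (Out (Spliced Q) \<alpha>) = col_map p (NOut S x)"
proof -
  show a: "x \<in> Nodes S" "\<alpha> \<in> Opn (Spliced Q)"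
    "opn_map (spliced_map F) \<alpha> = opn_map p (corolla S x)"
    using assms by (auto simp: pullback_species_def)
  show "map (map_prod (obj_map F) (obj_map F)) (Ins (Spliced Q) \<alpha>) = map (col_map p) (NIn S x)"
    using WF.Ins_opn_map[OF a(2)] p.Ins_opn_map[OF corolla_in[OF a(1)]] a(3)
    by (simp add: corolla_io) (simp add: spliced_map_def)
  show "map_prod (obj_map F) (obj_map F) (Out (Spliced Q) \<alpha>) = col_map p (NOut S x)"
    using WF.Out_opn_map[OF a(2)] p.Out_opn_map[OF corolla_in[OF a(1)]] a(3)
    by (simp add: corolla_io) (simp add: spliced_map_def)
qed

lemma species_pullback: "species (pullback_species G M)"
proof
  fix n assume n: "n \<in> Nodes (pullback_species G M)"
  obtain x \<alpha> where [simp]: "n = (x, \<alpha>)" by force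
  note N = node_pullback[OF n[simplified]]
  have o: "Out (Spliced Q) \<alpha> \<in> Col (Spliced Q)" by (rule WF.source.Out_in[OF N(2)])
  show "NOut (pullback_species G M) n \<in> Colors (pullback_species G M)"
    using o S.NOut_in[OF N(1)] N(5)
    by (cases "Out (Spliced Q) \<alpha>") (auto simp: pullback_species_def Spliced_def)
  have i: "set (Ins (Spliced Q) \<alpha>) \<subseteq> Col (Spliced Q)" by (rule WF.source.Ins_in[OF N(2)])
  have j: "set (NIn S x) \<subseteq> Colors S" by (rule S.NIn_in[OF N(1)])
  have "col_map p R = (obj_map F q, obj_map F q') \<and> R \<in> Colors S \<and> q \<in> Obj Q \<and> q' \<in> Obj Q"
    if z: "((q, q'), R) \<in> set (zip (Ins (Spliced Q) \<alpha>) (NIn S x))" for q q' R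
  proof -
    have "(q, q') \<in> Col (Spliced Q)" "R \<in> Colors S"
      using z i j by (auto elim!: in_set_zipE)
    moreover have "map_prod (obj_map F) (obj_map F) (q, q') = col_map p R"
    proof -
      from z obtain i where i: "i < length (Ins (Spliced Q) \<alpha>)" "i < length (NIn S x)"
        "Ins (Spliced Q) \<alpha> ! i = (q, q')" "NIn S x ! i = R" by (auto simp: in_set_zip)
      show ?thesis using arg_cong[OF N(4), of "\<lambda>l. l ! i"] i by simp
    qed
    ultimately show ?thesis by (auto simp: Spliced_def)
  qed
  then show "set (NIn (pullback_species G M) n) \<subseteq> Colors (pullback_species G M)"
    by (auto simp: pullback_species_def)
qed

lemma finite_arr_fiber: "finite X \<Longrightarrow> X \<subseteq> Arr C \<Longrightarrow> finite {\<alpha> \<in> Arr Q. arr_map F \<alpha> \<in> X}"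
proof -
  assume X: "finite X" "X \<subseteq> Arr C"
  have "{\<alpha> \<in> Arr Q. arr_map F \<alpha> \<in> X} = (\<Union>w\<in>X. {\<alpha> \<in> Arr Q. arr_map F \<alpha> = w})" by auto
  moreover have "finite (\<Union>w\<in>X. {\<alpha> \<in> Arr Q. arr_map F \<alpha> = w})"
    using X m_finitary base by (auto simp: finitary_def)
  ultimately show ?thesis by simp
qed

lemma finite_obj: "finite (Obj Q)"
proof -
  have "Obj Q = (\<Union>A\<in>Obj C. {q \<in> Obj Q. obj_map F q = A})" using F.obj_map_in by auto
  moreover have "finite (\<Union>A\<in>Obj C. {q \<in> Obj Q. obj_map F q = A})"
    using m_finitary base g_finitely_generated by (auto simp: finitary_def finitely_generated_def)
  ultimately show ?thesis by simp
qed

lemma ULF_unique: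
  assumes "Cod C u = Dom C v" "u \<in> Arr C" "v \<in> Arr C" "arr_map F (Comp Q b c) = Comp C u v"
    "b \<in> Arr Q" "c \<in> Arr Q" "Cod Q b = Dom Q c" "arr_map F b = u" "arr_map F c = v"
    "b' \<in> Arr Q" "c' \<in> Arr Q" "Cod Q b' = Dom Q c'" "arr_map F b' = u" "arr_map F c' = v"
    "Comp Q b c = Comp Q b' c'"
  shows "b = b' \<and> c = c'"
proof -
  have "Comp Q b c \<in> Arr Q" using F.source.Comp_in[OF assms(5,6,7)] by (simp add: hom_def)
  then have "\<exists>!(\<beta>, \<gamma>). \<beta> \<in> Arr Q \<and> \<gamma> \<in> Arr Q \<and> Cod Q \<beta> = Dom Q \<gamma> \<and>
      Comp Q b c = Comp Q \<beta> \<gamma> \<and> arr_map F \<beta> = u \<and> arr_map F \<gamma> = v" (is "\<exists>!z. ?P z")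
    using m_ULF assms(1-4) unfolding base ULF_def by blast
  moreover have "?P (b, c)" using assms(5-9) by simp
  moreover have "?P (b', c')" using assms(10-15) by simp
  ultimately have "(b, c) = (b', c')" by blast
  then show ?thesis by simp
qed

lemma lift_Idn:
  assumes "\<alpha> \<in> Arr Q" "arr_map F \<alpha> = Idn C A" "A \<in> Obj C"
  shows "\<alpha> = Idn Q (Dom Q \<alpha>)"
proof -
  let ?l = "Idn Q (Dom Q \<alpha>)" and ?r = "Idn Q (Cod Q \<alpha>)" and ?i = "Idn C A"
  have i: "?i \<in> Arr C" "Dom C ?i = A" "Cod C ?i = A" using F.target.Idn_in[OF assms(3)] by (auto simp: hom_def)
  have A: "obj_map F (Dom Q \<alpha>) = A" "obj_map F (Cod Q \<alpha>) = A"
    using F.arr_map_props[OF assms(1)] assms(2) i by auto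
  have o: "Dom Q \<alpha> \<in> Obj Q" "Cod Q \<alpha> \<in> Obj Q" using assms(1) F.source.Dom_in F.source.Cod_in by auto
  have l: "?l \<in> Arr Q" "Cod Q ?l = Dom Q \<alpha>" "arr_map F ?l = ?i" 
    using F.source.Idn_in[OF o(1)] F.arr_map_Idn[OF o(1)] A by (auto simp: hom_def)
  have r: "?r \<in> Arr Q" "Dom Q ?r = Cod Q \<alpha>" "arr_map F ?r = ?i"
    using F.source.Idn_in[OF o(2)] F.arr_map_Idn[OF o(2)] A by (auto simp: hom_def)
  have ii: "Comp C ?i ?i = ?i" using F.target.Comp_Idn_left[OF i(1)] i(2) by simp
  have c: "Comp Q \<alpha> ?r = \<alpha>" "Comp Q ?l \<alpha> = \<alpha>"
    using F.source.Comp_Idn_left F.source.Comp_Idn_right assms(1) by auto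
  show ?thesis
    using ULF_unique[of ?i ?i \<alpha> ?r ?l \<alpha>] i l r ii c assms by simp
qed

lemma finitely_generated_Q: "finitely_generated Q"
proof -
  obtain X where X: "finite X" "X \<subseteq> Arr C" "Arr C \<subseteq> generated_arrows C X"
    using g_finitely_generated by (auto simp: finitely_generated_def)
  let ?Y = "{\<alpha> \<in> Arr Q. arr_map F \<alpha> \<in> X}"
  have "\<alpha> \<in> generated_arrows Q ?Y" if "w \<in> generated_arrows C X" "\<alpha> \<in> Arr Q" "arr_map F \<alpha> = w" for w \<alpha>
    using that
  proof (induction arbitrary: \<alpha>)
    case (Idn A)
    from lift_Idn[OF Idn(2,3,1)] show ?case
      using generated_arrows.Idn[OF F.source.Dom_in[OF Idn(2)]] by metis
  next
    case (Comp x g)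
    have x: "x \<in> Arr C" using Comp(1) X(2) by auto
    have g: "g \<in> Arr C"
      using Comp(2) by induction (use X(2) F.target.Idn_in F.target.Comp_in in \<open>auto simp: hom_def\<close>)
    from m_ULF Comp.prems x g Comp(3) have "\<exists>!(\<beta>, \<gamma>). \<beta> \<in> Arr Q \<and> \<gamma> \<in> Arr Q \<and>
      Cod Q \<beta> = Dom Q \<gamma> \<and> \<alpha> = Comp Q \<beta> \<gamma> \<and> arr_map F \<beta> = x \<and> arr_map F \<gamma> = g"
      unfolding base ULF_def by blast
    then obtain b c where
      "b \<in> Arr Q" "c \<in> Arr Q" "Cod Q b = Dom Q c" "\<alpha> = Comp Q b c" "arr_map F b = x" "arr_map F c = g"
      by (elim ex1E) (auto split: prod.splits)
    then show ?case using Comp(1) Comp.IH[of c] by (auto intro!: generated_arrows.Comp)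
  qed
  then have "Arr Q \<subseteq> generated_arrows Q ?Y" using X(3) F.arr_map_props(1) by blast
  then show ?thesis using finite_obj finite_arr_fiber[OF X(1,2)]
    unfolding finitely_generated_def by blast
qed

lemma finite_pullback: "finite_species (pullback_species G M)"
proof -
  have fin: "finite (Colors S)" "finite (Nodes S)" using g_finite_species by (auto simp: finite_species_def)
  have "Colors (pullback_species G M) \<subseteq> Obj Q \<times> Colors S \<times> Obj Q" by (auto simp: pullback_species_def)
  then have 1: "finite (Colors (pullback_species G M))"
    by (rule finite_subset) (use fin finite_obj in auto)
  let ?w = "\<lambda>x. opn_map p (corolla S x)"
  let ?L = "\<lambda>x. {\<alpha>. set \<alpha> \<subseteq> {a \<in> Arr Q. arr_map F a \<in> set (?w x)} \<and> length \<alpha> = length (?w x)}"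
  have "Nodes (pullback_species G M) \<subseteq> Sigma (Nodes S) ?L"
  proof
    fix n assume n': "n \<in> Nodes (pullback_species G M)"
    obtain x \<alpha> where [simp]: "n = (x, \<alpha>)" by force
    have n: "(x, \<alpha>) \<in> Nodes (pullback_species G M)" using n' by simp
    note N = node_pullback[OF n]
    from N(3) have m: "map (arr_map F) \<alpha> = ?w x" by (simp add: spliced_map_def)
    have "set \<alpha> \<subseteq> Arr Q" using N(2) by (simp add: Spliced_def)
    then show "n \<in> Sigma (Nodes S) ?L"
      using N(1) by (auto simp flip: m)
  qed
  moreover have "finite (?L x)" if "x \<in> Nodes S" for x
  proof (intro finite_lists_length_eq finite_arr_fiber)
    show "set (?w x) \<subseteq> Arr C" using p.opn_map_in[OF corolla_in[OF that]] by (simp add: Spliced_def)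
  qed simp
  then have "finite (Sigma (Nodes S) ?L)" using fin by blast
  ultimately have "finite (Nodes (pullback_species G M))" by (rule finite_subset)
  with 1 show ?thesis by (simp add: finite_species_def)
qed

lemma cf_grammar_pullback:
  assumes "col_map p (g_start G) = (obj_map F (m_init M), obj_map F (m_final M))"
  shows "cf_grammar (pullback_grammar G M)"
proof (rule cf_grammar.intro)
  let ?S = "pullback_species G M" and ?G = "pullback_grammar G M"
  let ?k = "\<lambda>(q, R, q'). (q, q')" and ?v = "\<lambda>(x, \<alpha>). \<alpha>"
  show "category (g_cat ?G)" "finitely_generated (g_cat ?G)" "species (g_species ?G)" "finite_species (g_species ?G)"
    using F.source.category_axioms finitely_generated_Q species_pullback finite_pullback
    by (simp_all add: pullback_grammar_def)
  show "g_start ?G \<in> Colors (g_species ?G)"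
    using assms g_start_in m_init_in m_final_in by (simp add: pullback_grammar_def pullback_species_def)
  have "opd_functor (Free ?S) (Spliced Q) (free_extension (Spliced Q) ?k ?v)"
  proof (rule opd_functor_free_extension[OF species_pullback WF.source.operad_axioms])
    fix c assume "c \<in> Colors ?S"
    then show "?k c \<in> Col (Spliced Q)" by (auto simp: pullback_species_def Spliced_def)
  next
    fix n assume n: "n \<in> Nodes ?S"
    obtain x \<alpha> where [simp]: "n = (x, \<alpha>)" by force
    note N = node_pullback[OF n[simplified]]
    have "length (Ins (Spliced Q) \<alpha>) = length (NIn S x)" using N(4) by (metis length_map)
    then have "Ins (Spliced Q) \<alpha> = map ?k (NIn ?S n)"
      by (simp add: pullback_species_def case_prod_unfold o_def)
    moreover have "Out (Spliced Q) \<alpha> = ?k (NOut ?S n)"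
      by (simp add: pullback_species_def split: prod.split)
    ultimately show "?v n \<in> Opn (Spliced Q) \<and> Ins (Spliced Q) (?v n) = map ?k (NIn ?S n) \<and>
      Out (Spliced Q) (?v n) = ?k (NOut ?S n)" using N(2) by simp
  qed
  then show "opd_functor (Free (g_species ?G)) (Spliced (g_cat ?G)) (g_functor ?G)"
    by (simp add: pullback_grammar_def)
qed

end

end

theory Submission
  imports Defs
begin

text \<open>The free operad on the pullback species covers the pullback of \<open>p\<close> along \<open>\<W>[p\<^sub>M]\<close>:
  forgetting states sends a tree over \<open>S'\<close> to a tree over \<open>S\<close> with compatible values.
  Conversely, unique lifting of factorizations makes factorizations in the operad of spliced
  arrows lift along \<open>\<W>[p\<^sub>M]\<close>, so by induction on a tree \<open>t\<close> over \<open>S\<close>, every spliced arrow of the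
  automaton lying over \<open>p(t)\<close> is the value of a tree over \<open>S'\<close> that forgets to \<open>t\<close>.\<close>

section \<open>Trees as composites, and functors of operads on composites\<close>

lemma grafts_map_Leaf: "length ts = length cs \<Longrightarrow> grafts (map Leaf cs) ts = ts"
proof (induction cs arbitrary: ts)
  case (Cons c cs)
  then show ?case by (cases ts) auto
qed simp

text \<open>The functor \<open>p\<close> of a grammar is known only through the functor laws, not by
  recursion on trees. Presenting a node with subtrees as a composite with a corolla is what makes
  induction on trees usable for it.\<close>

lemma Node_as_Subst:
  assumes "species S" "x \<in> Nodes S" "set ts \<subseteq> typed_trees S" "map (root S) ts = NIn S x"
  shows "composable (Free S) (corolla S x) ts" "Subst (Free S) (corolla S x) ts = Node x ts"
proof -
  have "length ts = length (NIn S x)"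
    using assms(4) by (metis length_map)
  then show "Subst (Free S) (corolla S x) ts = Node x ts"
    by (simp add: Free_def corolla_def grafts_map_Leaf)
  show "composable (Free S) (corolla S x) ts"
    using assms species.NIn_in[OF assms(1,2)]
    by (auto simp: composable_def Free_def corolla_def o_def intro!: typed_trees.Node typed_trees.Leaf)
qed

lemma (in opd_functor) composable_map:
  assumes "composable P f gs"
  shows "composable R (opn_map \<phi> f) (map (opn_map \<phi>) gs)"
proof -
  have "set gs \<subseteq> Opn P" using assms by (simp add: composable_def)
  then have "map (Out R) (map (opn_map \<phi>) gs) = map (col_map \<phi>) (map (Out P) gs)"
    by (simp add: Out_opn_map subset_iff)
  then show ?thesis
    using assms opn_map_in by (auto simp: composable_def Ins_opn_map simp del: map_map)
qed

lemma leaves_map_tree: "leaves (map_tree f g t) = map f (leaves t)"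
  by (induction t) (auto simp: map_concat o_def intro!: arg_cong[of _ _ concat])

context grammar_nfa
begin

section \<open>Trees over the pullback species: their values and their underlying trees\<close>

abbreviation (input) "S' \<equiv> pullback_species G M"
abbreviation (input) "states \<equiv> \<lambda>(q, R, q'). (q, q')"
text \<open>This is the action on operations of the functor of
  \<open>pullback_grammar G M\<close>.\<close>

abbreviation (input) "value' \<equiv> eval_tree (Spliced Q) states (\<lambda>(x, \<alpha>). \<alpha>)"
abbreviation (input) "forget \<equiv> map_tree (\<lambda>(q, R, q'). R) fst"

lemma p_Node:
  assumes "x \<in> Nodes S" "set ts \<subseteq> typed_trees S" "map (root S) ts = NIn S x"
  shows "opn_map p (Node x ts) = fill_gaps C (opn_map p (corolla S x)) (map (opn_map p) ts)"
    and "composable (Spliced C) (opn_map p (corolla S x)) (map (opn_map p) ts)"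
proof -
  note N = Node_as_Subst[OF g_species assms]
  show "opn_map p (Node x ts) = fill_gaps C (opn_map p (corolla S x)) (map (opn_map p) ts)"
    using p.opn_map_Subst[OF N(1)] by (simp add: N(2)) (simp add: Spliced_def)
  show "composable (Spliced C) (opn_map p (corolla S x)) (map (opn_map p) ts)"
    by (rule p.composable_map[OF N(1)])
qed

lemma pullback_node_typing:
  assumes "n \<in> Nodes S'"
  shows "snd n \<in> Opn (Spliced Q)" "Ins (Spliced Q) (snd n) = map states (NIn S' n)"
    "Out (Spliced Q) (snd n) = states (NOut S' n)"
    "map (\<lambda>(q, R, q'). R) (NIn S' n) = NIn S (fst n)"
proof -
  obtain x \<alpha> where n: "n = (x, \<alpha>)" by force
  note N = node_pullback[OF assms[unfolded n]]
  have "length (Ins (Spliced Q) \<alpha>) = length (NIn S x)" using N(4) by (metis length_map)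
  then show "Ins (Spliced Q) (snd n) = map states (NIn S' n)"
    "map (\<lambda>(q, R, q'). R) (NIn S' n) = NIn S (fst n)"
    by (simp_all add: n pullback_species_def case_prod_unfold o_def)
  show "snd n \<in> Opn (Spliced Q)" "Out (Spliced Q) (snd n) = states (NOut S' n)"
    using N(2) by (simp_all add: n pullback_species_def split: prod.split)
qed

lemma value'_typing:
  assumes "t \<in> typed_trees S'"
  shows "value' t \<in> Opn (Spliced Q)" "Out (Spliced Q) (value' t) = states (root S' t)"
    "t = Node n ts \<Longrightarrow> composable (Spliced Q) (snd n) (map value' ts)"
proof -
  have k: "states c \<in> Col (Spliced Q)" if "c \<in> Colors S'" for c
    using that by (auto simp: pullback_species_def Spliced_def)
  have v: "(\<lambda>(x, \<alpha>). \<alpha>) n \<in> Opn (Spliced Q) \<and>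
      Ins (Spliced Q) ((\<lambda>(x, \<alpha>). \<alpha>) n) = map states (NIn S' n) \<and>
      Out (Spliced Q) ((\<lambda>(x, \<alpha>). \<alpha>) n) = states (NOut S' n)" if "n \<in> Nodes S'" for n
    using pullback_node_typing[OF that] by (simp add: snd_def)
  note E = Out_eval[where k = states and v = "\<lambda>(x, \<alpha>). \<alpha>", OF WF.source.operad_axioms k v assms]
  show "value' t \<in> Opn (Spliced Q)" "Out (Spliced Q) (value' t) = states (root S' t)"
    using E by auto
  show "t = Node n ts \<Longrightarrow> composable (Spliced Q) (snd n) (map value' ts)"
    using E by (auto simp: snd_def)
qed

lemma root_forget: "root S (forget t) = (\<lambda>(q, R, q'). R) (root S' t)"
  by (cases t) (auto simp: pullback_species_def split: prod.split)

text \<open>The square of \<open>value'\<close>, \<open>forget\<close>, \<open>p\<close> and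
  \<open>spliced_map F\<close> commutes: on nodes \<open>(x, \<alpha>)\<close> this is the defining
  condition of the pullback species, and it extends to trees because all the maps respect identities
  and composition.\<close>

lemma forget_typed_and_value:
  assumes "t \<in> typed_trees S'"
  shows "forget t \<in> typed_trees S \<and> map (arr_map F) (value' t) = opn_map p (forget t)"
  using assms
proof induction
  case (Leaf c)
  obtain q R q' where c: "c = (q, R, q')" by (cases c)
  have R: "R \<in> Colors S" "q \<in> Obj Q" "q' \<in> Obj Q" "col_map p R = (obj_map F q, obj_map F q')"
    using Leaf by (auto simp: c pullback_species_def)
  have "opn_map p (Leaf R) = [Idn C (obj_map F q), Idn C (obj_map F q')]"
    using p.opn_map_Ident[of R] R by (simp add: Free_def Spliced_def)
  then show ?case
    using R by (auto simp: c Spliced_def F.arr_map_Idn intro: typed_trees.Leaf)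
next
  case (Node n ts)
  obtain x \<alpha> where n: "n = (x, \<alpha>)" by force
  note N = node_pullback[OF Node.hyps(1)[unfolded n]]
  have "map (root S) (map forget ts) = map (\<lambda>(q, R, q'). R) (map (root S') ts)"
    by (simp add: root_forget)
  then have ts: "set (map forget ts) \<subseteq> typed_trees S" "map (root S) (map forget ts) = NIn S x"
    using Node.IH pullback_node_typing(4)[OF Node.hyps(1)]
    by (auto simp: n Node.hyps(2) simp del: map_map)
  have "Node n ts \<in> typed_trees S'"
    using Node by (intro typed_trees.Node) auto
  from value'_typing(3)[OF this] have "composable (Spliced Q) \<alpha> (map value' ts)"
    by (simp add: n)
  from F.fill_gaps_map[OF this]
  have "map (arr_map F) (value' (Node n ts)) =
      fill_gaps C (opn_map p (corolla S x)) (map (opn_map p) (map forget ts))"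
    using N(3) Node.IH by (simp add: n Spliced_def spliced_map_def o_def cong: map_cong)
  with p_Node[OF N(1) ts] show ?case
    using N(1) ts by (auto simp: n intro!: typed_trees.Node)
qed

section \<open>Lifting of factorizations from arrows to spliced arrows and trees\<close>

lemma Comp_lift:
  assumes "\<alpha> \<in> Arr Q" "u \<in> Arr C" "v \<in> Arr C" "Cod C u = Dom C v" "arr_map F \<alpha> = Comp C u v"
  obtains \<beta> \<gamma> where "\<beta> \<in> Arr Q" "\<gamma> \<in> Arr Q" "Cod Q \<beta> = Dom Q \<gamma>" "\<alpha> = Comp Q \<beta> \<gamma>"
    "arr_map F \<beta> = u" "arr_map F \<gamma> = v"
proof -
  from m_ULF assms have "\<exists>!(\<beta>, \<gamma>). \<beta> \<in> Arr Q \<and> \<gamma> \<in> Arr Q \<and> Cod Q \<beta> = Dom Q \<gamma> \<and>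
      \<alpha> = Comp Q \<beta> \<gamma> \<and> arr_map F \<beta> = u \<and> arr_map F \<gamma> = v"
    unfolding base ULF_def by blast
  then show thesis by (elim ex1E) (auto split: prod.splits intro: that)
qed

text \<open>Juxtaposition composes arrows at a single position, so \<open>ws\<close> is cut at that
  position and only the arrow there has to be factored, by \<open>Comp_lift\<close>.\<close>

lemma juxt_lift:
  assumes "F.target.fits us vs" "ws \<in> F.source.sp" "map (arr_map F) ws = juxt C us vs"
  obtains us' vs' where "F.source.fits us' vs'" "ws = juxt Q us' vs'"
    "map (arr_map F) us' = us" "map (arr_map F) vs' = vs"
proof -
  obtain us\<^sub>0 u v vs\<^sub>0 where uv: "us = us\<^sub>0 @ [u]" "vs = v # vs\<^sub>0"
    using assms(1) by (cases us rule: rev_cases; cases vs) (auto simp: F.target.fits_def F.target.sp_def)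
  have "map (arr_map F) ws = us\<^sub>0 @ Comp C u v # vs\<^sub>0"
    using assms(3) by (simp add: uv juxt_def)
  then obtain us\<^sub>1 w vs\<^sub>1 where ws: "ws = us\<^sub>1 @ w # vs\<^sub>1" "map (arr_map F) us\<^sub>1 = us\<^sub>0"
      "arr_map F w = Comp C u v" "map (arr_map F) vs\<^sub>1 = vs\<^sub>0"
    by (auto simp: map_eq_append_conv)
  obtain \<beta> \<gamma> where "\<beta> \<in> Arr Q" "\<gamma> \<in> Arr Q" "Cod Q \<beta> = Dom Q \<gamma>" "w = Comp Q \<beta> \<gamma>"
      "arr_map F \<beta> = u" "arr_map F \<gamma> = v"
    by (rule Comp_lift[of w u v])
      (use assms(1,2) ws in \<open>auto simp: uv F.target.fits_def F.target.sp_def F.source.sp_def\<close>)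
  then show thesis
    using assms(2) ws
    by (intro that[of "us\<^sub>1 @ [\<beta>]" "\<gamma> # vs\<^sub>1"])
      (auto simp: uv juxt_def F.source.fits_def F.source.sp_def)
qed

text \<open>Filling gaps is iterated juxtaposition: \<open>juxt_lift\<close> first splits off a lift
  of the leading arrow, then a lift of the first filler, and the induction hypothesis factors what
  remains.\<close>

lemma fill_gaps_lift:
  assumes "composable (Spliced C) ws gs" "us \<in> F.source.sp" "map (arr_map F) us = fill_gaps C ws gs"
  shows "\<exists>ws' gs'. composable (Spliced Q) ws' gs' \<and> us = fill_gaps Q ws' gs' \<and>
    map (arr_map F) ws' = ws \<and> map (map (arr_map F)) gs' = gs"
  using assms
proof (induction gs arbitrary: ws us)
  case Nil
  then obtain w where "ws = [w]" by (auto simp: F.target.composable_Nil)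
  with Nil show ?case
    by (intro exI[of _ us] exI[of _ "[]"]) (auto simp: F.source.composable_Nil F.source.sp_def)
next
  case (Cons g gs)
  then obtain w ws\<^sub>0 where ws: "ws = w # ws\<^sub>0" and f: "w \<in> Arr C" "F.target.fits [w] g"
      "F.target.fits g ws\<^sub>0" "composable (Spliced C) ws\<^sub>0 gs"
    by (auto simp: F.target.composable_Cons)
  have a: "F.target.fits g (fill_gaps C ws\<^sub>0 gs)"
    using F.target.fill_props[OF f(4)] f(3) by (auto simp: F.target.fits_def)
  have b: "F.target.fits [w] (juxt C g (fill_gaps C ws\<^sub>0 gs))"
    using a f(2) by (simp add: F.target.fits_juxt_right)
  obtain us\<^sub>1 us\<^sub>2 where 1: "F.source.fits us\<^sub>1 us\<^sub>2" "us = juxt Q us\<^sub>1 us\<^sub>2"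
      "map (arr_map F) us\<^sub>1 = [w]" "map (arr_map F) us\<^sub>2 = juxt C g (fill_gaps C ws\<^sub>0 gs)"
    by (rule juxt_lift[OF b Cons.prems(2)]) (use Cons.prems(3) in \<open>auto simp: ws\<close>)
  obtain g' us\<^sub>3 where 2: "F.source.fits g' us\<^sub>3" "us\<^sub>2 = juxt Q g' us\<^sub>3"
      "map (arr_map F) g' = g" "map (arr_map F) us\<^sub>3 = fill_gaps C ws\<^sub>0 gs"
    by (rule juxt_lift[OF a _ 1(4)]) (use 1(1) in \<open>auto simp: F.source.fits_def\<close>)
  obtain ws\<^sub>1 gs' where 3: "composable (Spliced Q) ws\<^sub>1 gs'" "us\<^sub>3 = fill_gaps Q ws\<^sub>1 gs'"
      "map (arr_map F) ws\<^sub>1 = ws\<^sub>0" "map (map (arr_map F)) gs' = gs"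
    using Cons.IH[OF f(4) _ 2(4)] 2(1) by (auto simp: F.source.fits_def)
  obtain w' where w': "us\<^sub>1 = [w']" using 1(3) by auto
  \<comment> \<open>Filling gaps keeps the domain of the first arrow, so \<open>us\<^sub>3\<close>
    and \<open>ws\<^sub>1\<close> start at the same state.\<close>
  have "F.source.fits g' ws\<^sub>1"
    using F.source.fill_props[OF 3(1)] 2(1) 3(1,2)
    by (auto simp: F.source.fits_def F.source.composable_Spliced)
  moreover have "F.source.fits [w'] g'"
    using 1(1) 2(1) by (simp add: w' 2(2) F.source.fits_juxt_right)
  ultimately have "composable (Spliced Q) (w' # ws\<^sub>1) (g' # gs')"
    using 3(1) by (auto simp: F.source.composable_Cons F.source.fits_def F.source.sp_def)
  with 1 2 3 show ?case
    by (intro exI[of _ "w' # ws\<^sub>1"] exI[of _ "g' # gs'"]) (auto simp: ws w')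
qed

text \<open>At a node, \<open>fill_gaps_lift\<close> yields a spliced arrow over the corolla, which
  is the second component of a pullback node, and fillers over the values of the subtrees. The
  induction is over all \<open>\<gamma>\<close> because these fillers arise only from that
  factorization.\<close>

lemma tree_lift:
  assumes "t \<in> typed_trees S" "\<gamma> \<in> F.source.sp" "map (arr_map F) \<gamma> = opn_map p t"
  shows "\<exists>t'\<in>typed_trees S'. forget t' = t \<and> value' t' = \<gamma>"
  using assms
proof (induction arbitrary: \<gamma>)
  case (Leaf R)
  obtain A B where AB: "col_map p R = (A, B)" "A \<in> Obj C" "B \<in> Obj C"
    using p.col_map_in[of R] Leaf(1) by (cases "col_map p R") (auto simp: Free_def Spliced_def)
  have "map (arr_map F) \<gamma> = [Idn C A, Idn C B]"
    using Leaf(3) p.opn_map_Ident[of R] Leaf(1) AB by (simp add: Free_def Spliced_def)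
  then obtain a b where ab: "\<gamma> = [a, b]" "arr_map F a = Idn C A" "arr_map F b = Idn C B"
    by auto
  have arr: "a \<in> Arr Q" "b \<in> Arr Q" using Leaf(2) by (auto simp: ab F.source.sp_def)
  \<comment> \<open>By \<open>lift_Idn\<close>, arrows over identities are themselves identities, so
    the domains of \<open>a\<close> and \<open>b\<close> already determine the states of the
    leaf.\<close>
  let ?c = "(Dom Q a, R, Dom Q b)"
  have "obj_map F (Dom Q a) = A" "obj_map F (Dom Q b) = B"
    using F.arr_map_props[OF arr(1)] F.arr_map_props[OF arr(2)] ab
      F.target.Idn_in[OF AB(2)] F.target.Idn_in[OF AB(3)] by (auto simp: hom_def)
  then have "Leaf ?c \<in> typed_trees S'"
    using Leaf(1) AB arr F.source.Dom_in by (auto simp: pullback_species_def intro!: typed_trees.Leaf)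
  moreover have "value' (Leaf ?c) = \<gamma>"
    using lift_Idn[OF arr(1) ab(2) AB(2)] lift_Idn[OF arr(2) ab(3) AB(3)]
    by (simp add: Spliced_def ab)
  ultimately show ?case by (intro bexI[of _ "Leaf ?c"]) auto
next
  case (Node x ts)
  have ts: "set ts \<subseteq> typed_trees S" using Node.IH by auto
  note P = p_Node[OF Node.hyps(1) ts Node.hyps(2)]
  obtain \<alpha> gs where \<alpha>: "composable (Spliced Q) \<alpha> gs" "\<gamma> = fill_gaps Q \<alpha> gs"
      "map (arr_map F) \<alpha> = opn_map p (corolla S x)" "map (map (arr_map F)) gs = map (opn_map p) ts"
    using fill_gaps_lift[OF P(2) Node.prems(1)] Node.prems(2) P(1) by auto
  have len: "length gs = length ts" using \<alpha>(4) by (metis length_map)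
  have "\<exists>t'\<in>typed_trees S'. forget t' = ts ! i \<and> value' t' = gs ! i" if "i < length ts" for i
  proof -
    have "gs ! i \<in> F.source.sp"
      using \<alpha>(1) that len by (auto simp: F.source.composable_Spliced)
    moreover have "map (arr_map F) (gs ! i) = opn_map p (ts ! i)"
      using arg_cong[OF \<alpha>(4), of "\<lambda>l. l ! i"] that len by simp
    ultimately show ?thesis using Node.IH that by auto
  qed
  then obtain h where h: "\<And>i. i < length ts \<Longrightarrow>
      h i \<in> typed_trees S' \<and> forget (h i) = ts ! i \<and> value' (h i) = gs ! i"
    by metis
  let ?ts = "map h [0..<length ts]"
  have ts': "set ?ts \<subseteq> typed_trees S'" "map forget ?ts = ts" "map value' ?ts = gs"
    using h len by (auto intro: nth_equalityI)
  have n: "(x, \<alpha>) \<in> Nodes S'"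
    using Node.hyps(1) \<alpha>(1,3)
    by (auto simp: pullback_species_def spliced_map_def composable_def)
  \<comment> \<open>The chosen subtrees must fit under \<open>(x, \<alpha>)\<close>. The states at
    their roots are right because the fillers are composable with \<open>\<alpha>\<close>; the
    underlying colors are right because the subtrees forget to \<open>ts\<close>.\<close>
  have "map states (map (root S') ?ts) = map (Out (Spliced Q)) (map value' ?ts)"
    using ts'(1) value'_typing(2) by auto
  also have "\<dots> = Ins (Spliced Q) \<alpha>"
    unfolding ts' using \<alpha>(1) by (simp add: composable_def)
  also have "\<dots> = map states (NIn S' (x, \<alpha>))"
    using pullback_node_typing(2)[OF n] by simp
  finally have 1: "map states (map (root S') ?ts) = map states (NIn S' (x, \<alpha>))" .
  have "map (\<lambda>(q, R, q'). R) (map (root S') ?ts) = map (root S) (map forget ?ts)"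
    by (simp add: root_forget)
  also have "\<dots> = map (\<lambda>(q, R, q'). R) (NIn S' (x, \<alpha>))"
    unfolding ts'(2) Node.hyps(2) using pullback_node_typing(4)[OF n] by simp
  finally have 2: "map (\<lambda>(q, R, q'). R) (map (root S') ?ts) =
    map (\<lambda>(q, R, q'). R) (NIn S' (x, \<alpha>))" .
  \<comment> \<open>A color of the pullback species is determined by its pair of states together
    with its underlying color, so the two list equations combine into one.\<close>
  have "inj (\<lambda>c :: 's \<times> 'c \<times> 's. (states c, (\<lambda>(q, R, q'). R) c))"
    by (auto simp: inj_def)
  moreover have "map (\<lambda>c. (states c, (\<lambda>(q, R, q'). R) c)) cs = zip (map states cs) (map (\<lambda>(q, R, q'). R) cs)"
    for cs :: "('s \<times> 'c \<times> 's) list"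
    by (induction cs) auto
  ultimately have "map (root S') ?ts = NIn S' (x, \<alpha>)"
    using 1 2 by (metis (no_types, lifting) inj_map_eq_map)
  then have "Node (x, \<alpha>) ?ts \<in> typed_trees S'"
    using n ts'(1) by (intro typed_trees.Node) auto
  moreover have "forget (Node (x, \<alpha>) ?ts) = Node x ts" using ts'(2) by simp
  moreover have "value' (Node (x, \<alpha>) ?ts) = \<gamma>"
    using ts'(3) \<alpha>(2) by (simp add: Spliced_def)
  ultimately show ?case by blast
qed

section \<open>The languages of the pullback grammar and of its functorial image\<close>

lemma language_pullback_iff:
  "w \<in> language (pullback_grammar G M) \<longleftrightarrow>
    (\<exists>t\<in>typed_trees S'. leaves t = [] \<and> root S' t = (m_init M, g_start G, m_final M) \<and> value' t = [w])"
  by (auto simp: language_def constants_def pullback_grammar_def free_extension_def Free_def)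

lemma language_iff:
  "w \<in> language G \<longleftrightarrow>
    (\<exists>t\<in>typed_trees S. leaves t = [] \<and> root S t = g_start G \<and> opn_map p t = [w])"
  by (auto simp: language_def constants_def Free_def)

lemma language_pullback:
  "language (pullback_grammar G M) = arr_map F -` language G \<inter> hom Q (m_init M) (m_final M)"
proof (intro equalityI subsetI)
  fix w assume "w \<in> language (pullback_grammar G M)"
  then obtain t where t: "t \<in> typed_trees S'" "leaves t = []"
      "root S' t = (m_init M, g_start G, m_final M)" "value' t = [w]"
    by (auto simp: language_pullback_iff)
  have "w \<in> hom Q (m_init M) (m_final M)"
    using value'_typing(1,2)[OF t(1)] t(3,4) by (auto simp: Spliced_def boundary_def hom_def)
  moreover have "arr_map F w \<in> language G"
    unfolding language_iff using forget_typed_and_value[OF t(1)] t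
    by (intro bexI[of _ "forget t"]) (auto simp: root_forget leaves_map_tree)
  ultimately show "w \<in> arr_map F -` language G \<inter> hom Q (m_init M) (m_final M)" by simp
next
  fix w assume w: "w \<in> arr_map F -` language G \<inter> hom Q (m_init M) (m_final M)"
  then obtain t where t: "t \<in> typed_trees S" "leaves t = []" "root S t = g_start G"
      "opn_map p t = [arr_map F w]"
    by (auto simp: language_iff)
  obtain t' where t': "t' \<in> typed_trees S'" "forget t' = t" "value' t' = [w]"
    using tree_lift[OF t(1), of "[w]"] w t(4) by (auto simp: F.source.sp_def hom_def)
  have "leaves t' = []" using t(2) by (simp add: leaves_map_tree flip: t'(2))
  \<comment> \<open>The outer states are the domain and codomain of \<open>w\<close>, as
    \<open>t'\<close> has value \<open>[w]\<close>; the middle component is the root of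
    \<open>t\<close>.\<close>
  moreover have "root S' t' = (m_init M, g_start G, m_final M)"
    using t(3) value'_typing(2)[OF t'(1)] root_forget[of t'] w t'(2,3)
    by (auto simp: Spliced_def boundary_def hom_def split: prod.splits)
  ultimately show "w \<in> language (pullback_grammar G M)"
    using t' by (auto simp: language_pullback_iff)
qed

end

lemma language_functorial_image:
  "language (functorial_image D F G) = arr_map F ` language G"
  by (force simp: language_def functorial_image_def opd_map_comp_def spliced_map_def)

theorem proposition4p2:
  fixes G :: "('o, 'a, 'c, 'x) grammar" and M :: "('o, 'a, 's, 't) automaton"
  assumes "cf_grammar G" and "nfa M" and "m_base M = g_cat G"
    and "col_map (g_functor G) (g_start G) =
      (obj_map (m_functor M) (m_init M), obj_map (m_functor M) (m_final M))"
  shows "language (pullback_grammar G M) =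
      arr_map (m_functor M) -` language G \<inter> hom (m_cat M) (m_init M) (m_final M) \<and>
    language (functorial_image (g_cat G) (m_functor M) (pullback_grammar G M)) =
      language G \<inter> nfa_language M"
proof -
  interpret grammar_nfa G M
    using assms(1-3) by (intro grammar_nfa.intro grammar_nfa_axioms.intro)
  show ?thesis
    by (auto simp: language_functorial_image language_pullback nfa_language_def)
qed

end
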